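(* There exists a constant $C$ such that for all integers $n,k$ with $n>Ck>0$, every intersecting family $\mathcal F\subset \binom{[n]}{k}$ satisfies $\gamma(\mathcal F)\le \binom{n-3}{k-2}$. Moreover, if $\gamma(\mathcal F)=\binom{n-3}{k-2}$, then $\mathcal F$ is a subfamily of a family isomorphic to $\mathcal A_2:=\{A\in\binom{[n]}{k}: |A\cap[3]|\ge 2\}$ (i.e. of $\{A\in\binom{[n]}{k}: |A\cap T|\ge 2\}$ for some $3$-element set $T\subset[n]$).
   Context: $[n]=\{1,\dots,n\}$ and $\binom{[n]}{k}$ is the set of $k$-element subsets of $[n]$. A family is intersecting if any two of its sets intersect. For $i\in[n]$, the degree $\delta_i$ is the number of sets of $\mathcal F$ containing $i$; $\Delta(\mathcal F)=\max_i\delta_i$. The diversity of $\mathcal F$ is $\gamma(\mathcal F):=|\mathcal F|-\Delta(\mathcal F)$, the number of sets of $\mathcal F$ not containing a most popular element.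
   Formalization: The "Moreover" part is stated only for k ≥ 2; for k = 1 it is false, since F = {{1}} has diversity 0 = binom(n-3,-1) while A_2 is empty. The bound itself is stated for all k ≥ 1. *)

theory Defs
  imports Complex_Main "HOL-Library.Ramsey"
begin

definition intersecting :: "'a set set \<Rightarrow> bool" where
  "intersecting F \<longleftrightarrow> (\<forall>A\<in>F. \<forall>B\<in>F. A \<inter> B \<noteq> {})"

definition degree :: "'a set set \<Rightarrow> 'a \<Rightarrow> nat" where
  "degree F i = card {A \<in> F. i \<in> A}"

text \<open>The ground set is \<open>{1..n}\<close>; the maximum is meaningful only for \<open>n > 0\<close>.\<close>
definition max_degree :: "nat \<Rightarrow> nat set set \<Rightarrow> nat" where
  "max_degree n F = Max (degree F ` {1..n})"

text \<open>The subtraction does not truncate when \<open>F\<close> is finite and \<open>n > 0\<close>,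
  since every degree is at most \<open>card F\<close>.\<close>
definition diversity :: "nat \<Rightarrow> nat set set \<Rightarrow> nat" where
  "diversity n F = card F - max_degree n F"

definition family_A2 :: "nat \<Rightarrow> nat \<Rightarrow> nat set set" where
  "family_A2 n k = {A \<in> nsets {1..n} k. card (A \<inter> {1..3}) \<ge> 2}"

text \<open>Isomorphism of families on \<open>{1..n}\<close>: equality up to relabelling the ground set.\<close>
definition isomorphic_families :: "nat \<Rightarrow> nat set set \<Rightarrow> nat set set \<Rightarrow> bool" where
  "isomorphic_families n G H \<longleftrightarrow>
     (\<exists>\<pi>. bij_betw \<pi> {1..n} {1..n} \<and> G = (\<lambda>A. \<pi> ` A) ` H)"

text \<open>Binomial coefficient with an integer lower index, zero when that index is negative.
  With natural-number subtraction, the index \<open>k - 2\<close> would become \<open>0\<close> instead of \<open>-1\<close>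
  for \<open>k = 1\<close>, which would weaken an upper bound.\<close>
definition binom :: "nat \<Rightarrow> int \<Rightarrow> nat" where
  "binom m j = (if j < 0 then 0 else m choose nat j)"

end

theory Submission
  imports Defs
begin

text \<open>
Write \<open>p = k / n\<close> and \<open>\<beta> = (n - 3 choose k - 2)\<close>, which is at least \<open>p\<^sup>2 / 4\<close> times
\<open>(n choose k)\<close>. Suppose every element is missed by at least \<open>\<beta>\<close> members of \<open>F\<close>; the claim is
that \<open>F\<close> is contained in a two-out-of-three family. Apply shifts to \<open>F\<close> as long as the shifted
family is still a counterexample. If the shift of a pair \<open>{i, j}\<close> is blocked, then \<open>{i, j}\<close> meets
more than half of \<open>F\<close>. Six disjoint blocked pairs would force a quarter of \<open>F\<close> to meet a fixed
12-element set in at least three points, which is impossible because such sets have density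
\<open>O(p\<^sup>3)\<close>. Hence \<open>F\<close> is shifted outside at most ten elements, and then all but an \<open>O(p\<^sup>3)\<close>
proportion of the \<open>k\<close>-sets in it already intersect pairwise inside a set \<open>U\<close> of at most 16
elements, with traces of size at most two. The traces form a star, which contradicts the
diversity, or lie in a triangle. In the triangle case shiftedness also excludes the exceptional
sets. The same method first gives an element of degree above \<open>card F / 2\<close>, hence
\<open>card F > 2 * \<beta>\<close>.
\<close>

section \<open>Counting sets with large intersections\<close>

text \<open>The left side arises from \<open>N choose k\<close> through \<open>r\<close> factors
  \<open>(k - i) / (N - i)\<close>, each at most \<open>k / N\<close> because
  \<open>k \<le> N\<close>.\<close>

lemma binomial_diff_le_power:
  assumes "r \<le> k" "k \<le> N"
  shows "real ((N - r) choose (k - r)) \<le> (real k / real N) ^ r * real (N choose k)"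
  using assms(1)
proof (induction r)
  case 0
  then show ?case by simp
next
  case (Suc r)
  have "(k - r) * ((N - r) choose (k - r)) = (N - r) * ((N - Suc r) choose (k - Suc r))"
    using binomial_absorption[of "k - Suc r" "N - r"] Suc.prems by (simp add: Suc_diff_Suc)
  then have "real (k - r) * real ((N - r) choose (k - r))
      = real (N - r) * real ((N - Suc r) choose (k - Suc r))"
    by (metis of_nat_mult)
  moreover have "real (N - r) > 0" using Suc.prems assms by simp
  ultimately have eq: "real ((N - Suc r) choose (k - Suc r))
      = real (k - r) / real (N - r) * real ((N - r) choose (k - r))"
    by (simp add: field_simps)
  have "real r * real k \<le> real r * real N"
    using assms by (intro mult_left_mono) auto
  then have ratio: "real (k - r) / real (N - r) \<le> real k / real N"
    using Suc.prems assms by (simp add: field_simps of_nat_diff)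
  have "real ((N - Suc r) choose (k - Suc r)) \<le> (real k / real N) * ((real k / real N) ^ r * real (N choose k))"
    unfolding eq using ratio Suc by (intro mult_mono) auto
  then show ?case by simp
qed

lemma finite_nsets: "finite X \<Longrightarrow> finite (nsets X k)"
  unfolding nsets_def by (rule finite_subset[of _ "Pow X"]) auto

lemma card_nsets_eq: "finite X \<Longrightarrow> card (nsets X k) = card X choose k"
proof -
  assume "finite X"
  moreover from this have "nsets X k = {B. B \<subseteq> X \<and> card B = k}"
    by (auto simp: nsets_def intro: finite_subset)
  ultimately show ?thesis using n_subsets[of X k] by simp
qed

text \<open>Removing \<open>S\<close> is injective on these sets. In terms of probability, with
  \<open>p = k / card X\<close>, a random \<open>k\<close>-set contains \<open>S\<close> with chance
  at most \<open>p ^ card S\<close>.\<close>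

lemma card_nsets_superset:
  assumes "finite X" "S \<subseteq> X"
  shows "real (card {A \<in> nsets X k. S \<subseteq> A})
    \<le> (real k / real (card X)) ^ card S * real (card X choose k)"
proof (cases "card S \<le> k \<and> k \<le> card X")
  case True
  have fS: "finite S" using assms finite_subset by blast
  have "card {A \<in> nsets X k. S \<subseteq> A} \<le> card (nsets (X - S) (k - card S))"
  proof (rule card_inj_on_le[of "\<lambda>A. A - S"])
    show "inj_on (\<lambda>A. A - S) {A \<in> nsets X k. S \<subseteq> A}"
      by (rule inj_onI) blast
    show "(\<lambda>A. A - S) ` {A \<in> nsets X k. S \<subseteq> A} \<subseteq> nsets (X - S) (k - card S)"
      using fS by (auto simp: nsets_def card_Diff_subset)
    show "finite (nsets (X - S) (k - card S))"
      using assms by (intro finite_nsets) auto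
  qed
  also have "\<dots> = (card X - card S) choose (k - card S)"
    using assms fS by (simp add: card_nsets_eq card_Diff_subset)
  finally show ?thesis
    using binomial_diff_le_power[of "card S" k "card X"] True by linarith
next
  case False
  have "{A \<in> nsets X k. S \<subseteq> A} = {}"
  proof (rule ccontr)
    assume "{A \<in> nsets X k. S \<subseteq> A} \<noteq> {}"
    then obtain A where "A \<subseteq> X" "finite A" "card A = k" "S \<subseteq> A"
      unfolding nsets_def by auto
    then show False using False assms card_mono by metis
  qed
  then show ?thesis by (simp only: card.empty) simp
qed

text \<open>Union bound over the \<open>r\<close>-subsets of \<open>V\<close>. For
  \<open>r = 3\<close> and \<open>V\<close> of bounded size it yields the \<open>O(p^3)\<close>
  error terms.\<close>

lemma card_nsets_meeting_ge:
  assumes "finite X" "V \<subseteq> X"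
  shows "real (card {A \<in> nsets X k. card (A \<inter> V) \<ge> r})
    \<le> real (card V choose r) * ((real k / real (card X)) ^ r * real (card X choose k))"
proof -
  have fV: "finite V" using assms finite_subset by blast
  have "{A \<in> nsets X k. card (A \<inter> V) \<ge> r} \<subseteq> (\<Union>S\<in>nsets V r. {A \<in> nsets X k. S \<subseteq> A})"
  proof
    fix A assume A: "A \<in> {A \<in> nsets X k. card (A \<inter> V) \<ge> r}"
    then obtain S where "S \<subseteq> A \<inter> V" "card S = r" "finite S"
      using obtain_subset_with_card_n[of r "A \<inter> V"] by auto
    then show "A \<in> (\<Union>S\<in>nsets V r. {A \<in> nsets X k. S \<subseteq> A})"
      using A by (auto simp: nsets_def)
  qed
  then have "card {A \<in> nsets X k. card (A \<inter> V) \<ge> r}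
      \<le> card (\<Union>S\<in>nsets V r. {A \<in> nsets X k. S \<subseteq> A})"
    using assms fV by (intro card_mono finite_UN_I) (auto simp: finite_nsets)
  also have "\<dots> \<le> (\<Sum>S\<in>nsets V r. card {A \<in> nsets X k. S \<subseteq> A})"
    using fV by (intro card_UN_le finite_nsets)
  finally have "real (card {A \<in> nsets X k. card (A \<inter> V) \<ge> r})
      \<le> (\<Sum>S\<in>nsets V r. real (card {A \<in> nsets X k. S \<subseteq> A}))"
    by (simp only: flip: of_nat_sum of_nat_le_iff)
  also have "\<dots> \<le> (\<Sum>S\<in>nsets V r. (real k / real (card X)) ^ r * real (card X choose k))"
  proof (rule sum_mono)
    fix S assume "S \<in> nsets V r"
    then have "S \<subseteq> X" "card S = r" using assms by (auto simp: nsets_def)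
    then show "real (card {A \<in> nsets X k. S \<subseteq> A}) \<le> (real k / real (card X)) ^ r * real (card X choose k)"
      using card_nsets_superset[of X S k] assms by simp
  qed
  also have "\<dots> = real (card V choose r) * ((real k / real (card X)) ^ r * real (card X choose k))"
    using fV by (simp add: card_nsets_eq)
  finally show ?thesis .
qed

section \<open>Sets that are dense on an initial segment\<close>

abbreviation (input) seg :: "nat set \<Rightarrow> nat \<Rightarrow> nat set" where
  "seg R v \<equiv> R \<inter> {..v}"

text \<open>Read \<open>R\<close> upwards as a walk that steps up at elements of \<open>A\<close>
  and down elsewhere: the walk reaches height at least \<open>t\<close>. Two sets that are both not
  overfull at \<open>t = 1\<close> satisfy the counting condition of
  \<open>shift_away\<close>.\<close>

definition overfull :: "nat set \<Rightarrow> nat \<Rightarrow> nat set \<Rightarrow> bool" where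
  "overfull R t A \<longleftrightarrow> (\<exists>v\<in>R. 2 * card (A \<inter> seg R v) \<ge> card (seg R v) + t)"

text \<open>This allows a sum over \<open>v\<close> to be reindexed by the length of the
  segment.\<close>

lemma inj_on_card_seg:
  assumes "finite R"
  shows "inj_on (\<lambda>v. card (seg R v)) R"
proof -
  have "card (seg R v) < card (seg R w)" if "v \<in> R" "w \<in> R" "v < w" for v w
  proof (rule psubset_card_mono)
    have "w \<in> seg R w - seg R v" "seg R v \<subseteq> seg R w" using that by auto
    then show "seg R v \<subset> seg R w" by blast
  qed (use assms in simp)
  then show ?thesis
    by (intro inj_onI) (metis nat_neq_iff)
qed

lemma geometric_tail_le:
  fixes x :: real
  assumes "0 \<le> x" "x \<le> 1/2"
  shows "(\<Sum>l\<in>{t..m}. x ^ l) \<le> 2 * x ^ t"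
proof (cases "t \<le> m")
  case True
  have "(1 - x) * (\<Sum>l\<in>{t..m}. x ^ l) = x ^ t - x ^ Suc m"
    using sum_gp_multiplied[OF True, of x] by simp
  also have "\<dots> \<le> x ^ t" using assms by simp
  finally have *: "(1 - x) * (\<Sum>l\<in>{t..m}. x ^ l) \<le> x ^ t" .
  have "(1/2) * (\<Sum>l\<in>{t..m}. x ^ l) \<le> (1 - x) * (\<Sum>l\<in>{t..m}. x ^ l)"
    using assms by (intro mult_right_mono sum_nonneg) auto
  then show ?thesis using * by linarith
next
  case False
  then show ?thesis using assms by simp
qed

text \<open>Union bound over the segments. For a segment of length \<open>l\<close> the density is
  at most \<open>2 ^ l * p ^ r\<close> with \<open>r\<close> half of \<open>l + t\<close> rounded
  up. With \<open>q = sqrt p\<close> this is at most \<open>q ^ t * (2 * q) ^ l\<close>, a geometric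
  series over \<open>l \<ge> t\<close> because \<open>2 * q \<le> 1/2\<close>.\<close>

lemma card_overfull_le:
  assumes X: "finite X" "R \<subseteq> X" and small: "16 * k \<le> card X"
  shows "real (card {A \<in> nsets X k. overfull R t A})
    \<le> 2 * (2 * (real k / real (card X))) ^ t * real (card X choose k)"
proof -
  define p where "p = real k / real (card X)"
  define q where "q = sqrt p"
  define M where "M = real (card X choose k)"
  have fR: "finite R" using X finite_subset by blast
  have p: "0 \<le> p" "p \<le> 1/16"
    using small unfolding p_def by (auto simp: divide_simps)
  have "sqrt p \<le> sqrt ((1/4)^2)" using p by (intro real_sqrt_le_mono) (simp add: power2_eq_square)
  then have q: "0 \<le> q" "q \<le> 1/4" "q\<^sup>2 = p"
    using p unfolding q_def by auto
  define l where "l v = card (seg R v)" for v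
  define E where "E v = {A \<in> nsets X k. 2 * card (A \<inter> seg R v) \<ge> l v + t}" for v
  have E: "real (card (E v)) \<le> (if t \<le> l v then q ^ t * (2 * q) ^ l v * M else 0)" if "v \<in> R" for v
  proof (cases "t \<le> l v")
    case True
    define r where "r = (l v + t + 1) div 2"
    have "E v = {A \<in> nsets X k. card (A \<inter> seg R v) \<ge> r}"
      unfolding E_def r_def by auto
    then have "real (card (E v)) \<le> real (l v choose r) * (p ^ r * M)"
      using card_nsets_meeting_ge[of X "seg R v" k r] X unfolding l_def p_def M_def by auto
    also have "\<dots> \<le> 2 ^ l v * (q ^ (l v + t) * M)"
    proof (intro mult_mono)
      have "real (l v choose r) \<le> real (2 ^ l v)"
        using binomial_le_pow2 of_nat_le_iff by blast
      then show "real (l v choose r) \<le> 2 ^ l v" by simp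
      have "p ^ r = q ^ (2 * r)" using q by (simp add: power_mult)
      also have "\<dots> \<le> q ^ (l v + t)"
        using q unfolding r_def by (intro power_decreasing) auto
      finally show "p ^ r \<le> q ^ (l v + t)" .
    qed (use p q in \<open>auto simp: M_def\<close>)
    also have "\<dots> = q ^ t * (2 * q) ^ l v * M"
      by (simp add: power_add power_mult_distrib)
    finally show ?thesis using True by simp
  next
    case False
    have "E v = {}"
    proof -
      have "card (A \<inter> seg R v) \<le> l v" for A
        unfolding l_def using fR by (intro card_mono) auto
      then have "2 * card (A \<inter> seg R v) \<le> l v + l v" for A
        by (simp add: mult_2 add_mono)
      moreover have "l v + l v < l v + t" using False by simp
      ultimately show ?thesis unfolding E_def using leD order.strict_trans1 by blast
    qed
    then show ?thesis using False by simp
  qed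
  have "{A \<in> nsets X k. overfull R t A} = (\<Union>v\<in>R. E v)"
    unfolding overfull_def E_def l_def by auto
  then have "real (card {A \<in> nsets X k. overfull R t A}) \<le> real (\<Sum>v\<in>R. card (E v))"
    using card_UN_le[OF fR, of E] by (simp only: of_nat_le_iff)
  also have "\<dots> \<le> (\<Sum>v\<in>R. if t \<le> l v then q ^ t * (2 * q) ^ l v * M else 0)"
    using E by (auto intro: sum_mono)
  also have "\<dots> = (\<Sum>i\<in>l ` R. if t \<le> i then q ^ t * (2 * q) ^ i * M else 0)"
    using inj_on_card_seg[OF fR] unfolding l_def by (subst sum.reindex) auto
  also have "\<dots> = (\<Sum>i\<in>{i\<in>l ` R. t \<le> i}. q ^ t * (2 * q) ^ i * M)"
    using fR by (subst sum.inter_filter) auto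
  also have "\<dots> \<le> (\<Sum>i\<in>{t..card R}. q ^ t * (2 * q) ^ i * M)"
    using fR q unfolding l_def M_def by (intro sum_mono2) (auto intro!: card_mono)
  also have "\<dots> = q ^ t * (\<Sum>i\<in>{t..card R}. (2 * q) ^ i) * M"
    by (simp add: sum_distrib_left sum_distrib_right)
  also have "\<dots> \<le> q ^ t * (2 * (2 * q) ^ t) * M"
    using q geometric_tail_le[of "2 * q" t "card R"] unfolding M_def
    by (intro mult_right_mono mult_left_mono) auto
  also have "\<dots> = 2 * (2 * q\<^sup>2) ^ t * M"
    by (simp add: power_mult_distrib power2_eq_square)
  finally show ?thesis using q unfolding p_def M_def by simp
qed

section \<open>Comparing binomial coefficients with \<open>\<beta>\<close>\<close>

text \<open>Two absorptions lead from \<open>n choose k\<close> to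
  \<open>(n - 2) choose (k - 2)\<close>, with factors \<open>n / k\<close> and
  \<open>(n - 1) / (k - 1) \<le> 2 * n / k\<close>. Lowering \<open>n - 2\<close> to
  \<open>n - 3\<close> costs at most another factor two.\<close>

lemma binomial_le_sq_binomial:
  assumes "2 \<le> k" "8 * k \<le> n"
  shows "(real k / real n)\<^sup>2 * real (n choose k) \<le> 4 * real ((n - 3) choose (k - 2))"
proof -
  have 1: "real k * real (n choose k) = real n * real ((n - 1) choose (k - 1))"
    using binomial_absorption[of "k - 1" n] assms by (simp flip: of_nat_mult)
  have "(k - 1) * ((n - 1) choose (k - 1)) = (n - 1) * ((n - 2) choose (k - 2))"
    using binomial_absorption[of "k - 2" "n - 1"] assms
    by (simp add: Suc_diff_Suc numeral_2_eq_2)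
  then have "real (k - 1) * real ((n - 1) choose (k - 1)) = real (n - 1) * real ((n - 2) choose (k - 2))"
    by (simp only: flip: of_nat_mult)
  then have 2: "(real k - 1) * real ((n - 1) choose (k - 1)) = (real n - 1) * real ((n - 2) choose (k - 2))"
    using assms by simp
  have "((n - 2) - (k - 2)) * ((n - 2) choose (k - 2)) = (n - 2) * ((n - 2 - 1) choose (k - 2))"
    using binomial_absorb_comp by blast
  moreover have "(n - 2) - (k - 2) = n - k" "n - 2 - 1 = n - 3" using assms by auto
  ultimately have "(n - k) * ((n - 2) choose (k - 2)) = (n - 2) * ((n - 3) choose (k - 2))"
    by simp
  then have "real (n - k) * real ((n - 2) choose (k - 2)) = real (n - 2) * real ((n - 3) choose (k - 2))"
    by (simp only: flip: of_nat_mult)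
  then have 3: "(real n - real k) * real ((n - 2) choose (k - 2)) = (real n - 2) * real ((n - 3) choose (k - 2))"
    using assms by (simp add: of_nat_diff)
  define a b c d where "a = real (n choose k)" and "b = real ((n - 1) choose (k - 1))"
    and "c = real ((n - 2) choose (k - 2))" and "d = real ((n - 3) choose (k - 2))"
  define x y where "x = real k" and "y = real n"
  have xy: "x \<ge> 2" "8 * x \<le> y" using assms unfolding x_def y_def by auto
  have nn: "a \<ge> 0" "b \<ge> 0" "c \<ge> 0" "d \<ge> 0" unfolding a_def b_def c_def d_def by auto
  have "c * y \<le> 2 * ((y - x) * c)" 
    using mult_right_mono[of y "2 * (y - x)" c] xy nn by (simp add: algebra_simps)
  also have "\<dots> = 2 * ((y - 2) * d)" using 3 unfolding c_def d_def x_def y_def by simp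
  also have "\<dots> \<le> 2 * (y * d)" using nn by (simp add: algebra_simps)
  finally have cd: "c \<le> 2 * d" using xy by simp
  have "x * b \<le> 2 * ((x - 1) * b)"
    using mult_right_mono[of x "2 * (x - 1)" b] xy nn by (simp add: algebra_simps)
  also have "\<dots> = 2 * ((y - 1) * c)" using 2 unfolding b_def c_def x_def y_def by simp
  also have "\<dots> \<le> 2 * (y * c)" using nn by (simp add: algebra_simps)
  finally have bc: "x * b \<le> 2 * y * c" by simp
  have "x * x * a = y * (x * b)" using 1 unfolding a_def b_def x_def y_def by simp
  also have "\<dots> \<le> y * (2 * y * c)" using bc xy by (intro mult_left_mono) auto
  also have "\<dots> \<le> y * (2 * y * (2 * d))" using cd xy by (intro mult_left_mono) auto
  finally have "x * x * a \<le> (y * y) * (4 * d)" by (simp add: algebra_simps)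
  then have "(x / y)\<^sup>2 * a \<le> 4 * d" using xy by (simp add: power2_eq_square field_simps)
  then show ?thesis unfolding a_def d_def x_def y_def .
qed

text \<open>Each lowering of the top index from \<open>N - q\<close> costs the factor
  \<open>(N - q) / (N - q - j)\<close>, which is at most two while
  \<open>2 * j \<le> N - q\<close>.\<close>

lemma binomial_le_pow2_diff:
  assumes "2 * j + q \<le> N"
  shows "real (N choose j) \<le> 2 ^ q * real ((N - q) choose j)"
  using assms
proof (induction q)
  case 0
  then show ?case by simp
next
  case (Suc q)
  have "((N - q) - j) * ((N - q) choose j) = (N - q) * ((N - Suc q) choose j)"
    using binomial_absorb_comp[of "N - q" j] by simp
  moreover have "(N - q) \<le> 2 * ((N - q) - j)" using Suc.prems by simp
  ultimately have "(N - q) * ((N - q) choose j) \<le> (N - q) * (2 * ((N - Suc q) choose j))"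
    using mult_le_mono1[of "N - q" "2 * ((N - q) - j)" "(N - q) choose j"]
    by (simp only: mult.assoc mult.left_commute)
  then have "(N - q) choose j \<le> 2 * ((N - Suc q) choose j)"
    using Suc.prems by (subst (asm) mult_le_cancel1) auto
  then have "real ((N - q) choose j) \<le> 2 * real ((N - Suc q) choose j)" by linarith
  then have "2 ^ q * real ((N - q) choose j) \<le> 2 ^ q * (2 * real ((N - Suc q) choose j))"
    by (intro mult_left_mono) auto
  moreover have "real (N choose j) \<le> 2 ^ q * real ((N - q) choose j)" using Suc by simp
  moreover have "2 ^ q * (2 * real ((N - Suc q) choose j)) = 2 ^ Suc q * real ((N - Suc q) choose j)"
    by simp
  ultimately show ?case by linarith
qed

section \<open>Shifting\<close>

text \<open>The usual compression replacing \<open>j\<close> by \<open>i\<close>. A set stays in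
  place if its image is already in \<open>F\<close>, which makes the map injective on
  \<open>F\<close>.\<close>

definition shift_set :: "nat \<Rightarrow> nat \<Rightarrow> nat set set \<Rightarrow> nat set \<Rightarrow> nat set" where
  "shift_set i j F A =
     (if j \<in> A \<and> i \<notin> A \<and> insert i (A - {j}) \<notin> F then insert i (A - {j}) else A)"

definition shift :: "nat \<Rightarrow> nat \<Rightarrow> nat set set \<Rightarrow> nat set set" where
  "shift i j F = shift_set i j F ` F"

lemma inj_on_shift_set: "inj_on (shift_set i j F) F"
proof (rule inj_onI)
  fix A B assume AB: "A \<in> F" "B \<in> F" and eq: "shift_set i j F A = shift_set i j F B"
  have "A = B" if "j \<in> A" "i \<notin> A" "j \<in> B" "i \<notin> B" "insert i (A - {j}) = insert i (B - {j})"
    using that by (metis insert_Diff insert_ident Diff_iff)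
  then show "A = B"
    using AB eq unfolding shift_set_def by (auto split: if_splits)
qed

lemma card_shift: "card (shift i j F) = card F"
  unfolding shift_def by (rule card_image[OF inj_on_shift_set])

lemma shift_subset_nsets:
  assumes "F \<subseteq> nsets X k" "i \<in> X"
  shows "shift i j F \<subseteq> nsets X k"
proof -
  have "insert i (A - {j}) \<in> nsets X k" if "A \<in> nsets X k" "j \<in> A" "i \<notin> A" for A
  proof -
    have "finite A" using that by (simp add: nsets_def)
    then have "card (insert i (A - {j})) = Suc (card (A - {j}))" "card A = Suc (card (A - {j}))"
      using that card.remove[of A j] by (auto simp del: card_Diff_insert)
    then have "card (insert i (A - {j})) = card A" by simp
    then show ?thesis using that assms(2) by (auto simp: nsets_def)
  qed
  then show ?thesis
    using assms unfolding shift_def shift_set_def by auto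
qed

text \<open>Only a moved \<open>A\<close> and an unmoved \<open>B\<close> need care. If
  \<open>B\<close> contains \<open>j\<close> but not \<open>i\<close>, it stayed because its
  compression is in \<open>F\<close>, and that compression meets \<open>A\<close> outside
  \<open>{i, j}\<close>.\<close>

lemma intersecting_shift:
  assumes F: "intersecting F" and "i \<noteq> j"
  shows "intersecting (shift i j F)"
proof -
  have mixed: "insert i (A - {j}) \<inter> B \<noteq> {}"
    if "A \<in> F" "B \<in> F" "j \<in> A" "i \<notin> A" "\<not> (j \<in> B \<and> i \<notin> B \<and> insert i (B - {j}) \<notin> F)" for A B
  proof (cases "i \<in> B")
    case False
    show ?thesis
    proof (cases "j \<in> B")
      case True
      then have "A \<inter> insert i (B - {j}) \<noteq> {}"
        using that False F unfolding intersecting_def by blast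
      then show ?thesis using that by blast
    next
      case False
      have "A \<inter> B \<noteq> {}" using that F unfolding intersecting_def by blast
      then show ?thesis using False by blast
    qed
  qed auto
  have "shift_set i j F A \<inter> shift_set i j F B \<noteq> {}" if AB: "A \<in> F" "B \<in> F" for A B
  proof -
    define mv where "mv A \<longleftrightarrow> j \<in> A \<and> i \<notin> A \<and> insert i (A - {j}) \<notin> F" for A
    have eq: "shift_set i j F A = (if mv A then insert i (A - {j}) else A)" for A
      unfolding shift_set_def mv_def ..
    have m: "insert i (A - {j}) \<inter> B \<noteq> {}" if "A \<in> F" "B \<in> F" "mv A" "\<not> mv B" for A B
      using mixed that unfolding mv_def by metis
    have "A \<inter> B \<noteq> {}" using AB F unfolding intersecting_def by simp
    then show ?thesis
      using m[OF AB] m[OF AB(2,1)] unfolding eq by (cases "mv A"; cases "mv B") auto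
  qed
  then show ?thesis unfolding intersecting_def shift_def by auto
qed

section \<open>Degrees under shifting\<close>

lemma degree_shift_le:
  assumes "finite F" "x \<noteq> i"
  shows "degree (shift i j F) x \<le> degree F x"
proof -
  have "{A \<in> shift i j F. x \<in> A} \<subseteq> shift_set i j F ` {A \<in> F. x \<in> A}"
    using assms(2) unfolding shift_def shift_set_def by (auto split: if_splits)
  then have "card {A \<in> shift i j F. x \<in> A} \<le> card (shift_set i j F ` {A \<in> F. x \<in> A})"
    using assms by (intro card_mono) auto
  also have "\<dots> \<le> card {A \<in> F. x \<in> A}" using assms by (intro card_image_le) auto
  finally show ?thesis unfolding degree_def .
qed

text \<open>Only \<open>i\<close> can gain degree, and only from sets through \<open>j\<close>. Many
  sets missing both elements therefore keep the new degree of \<open>i\<close> under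
  control.\<close>

lemma degree_shift_self_le:
  assumes "finite F"
  shows "degree (shift i j F) i \<le> card {A \<in> F. i \<in> A \<or> j \<in> A}"
proof -
  have "{A \<in> shift i j F. i \<in> A} \<subseteq> shift_set i j F ` {A \<in> F. i \<in> A \<or> j \<in> A}"
    unfolding shift_def shift_set_def by (auto split: if_splits)
  then have "card {A \<in> shift i j F. i \<in> A} \<le> card (shift_set i j F ` {A \<in> F. i \<in> A \<or> j \<in> A})"
    using assms by (intro card_mono) auto
  also have "\<dots> \<le> card {A \<in> F. i \<in> A \<or> j \<in> A}" using assms by (intro card_image_le) auto
  finally show ?thesis unfolding degree_def .
qed

lemma card_meeting_plus_missing:
  assumes "finite F"
  shows "card {A \<in> F. i \<in> A \<or> j \<in> A} + card {A \<in> F. i \<notin> A \<and> j \<notin> A} = card F"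
proof -
  have "card F = card ({A \<in> F. i \<in> A \<or> j \<in> A} \<union> {A \<in> F. i \<notin> A \<and> j \<notin> A})"
    by (rule arg_cong[where f = card]) auto
  also have "\<dots> = card {A \<in> F. i \<in> A \<or> j \<in> A} + card {A \<in> F. i \<notin> A \<and> j \<notin> A}"
    using assms by (intro card_Un_disjoint) auto
  finally show ?thesis by simp
qed

lemma degree_plus_missing:
  assumes "finite F"
  shows "degree F i + card {A \<in> F. i \<notin> A} = card F"
  using card_meeting_plus_missing[OF assms, of i i] by (simp add: degree_def)

text \<open>The termination measure for repeated shifting: every moved set trades \<open>j\<close>
  for the smaller \<open>i\<close>.\<close>

lemma sum_shift_less:
  assumes F: "F \<subseteq> nsets X k" "finite F" and "i < j" and ne: "shift i j F \<noteq> F"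
  shows "(\<Sum>A\<in>shift i j F. \<Sum>A) < (\<Sum>A\<in>F. \<Sum>A)"
proof -
  have less: "\<Sum> (insert i (A - {j})) < \<Sum> A" if "A \<in> F" "j \<in> A" "i \<notin> A" for A
  proof -
    have "finite A" using that F by (auto simp: nsets_def)
    then have "\<Sum> (insert i (A - {j})) = i + \<Sum> (A - {j})" "\<Sum> A = j + \<Sum> (A - {j})"
      using that by (auto simp: sum.remove)
    then show ?thesis using \<open>i < j\<close> by simp
  qed
  have le: "\<Sum> (shift_set i j F A) \<le> \<Sum> A" if "A \<in> F" for A
    using less[of A] that unfolding shift_set_def by (auto intro: less_imp_le)
  have "\<exists>A\<in>F. shift_set i j F A \<noteq> A"
  proof (rule ccontr)
    assume "\<not> ?thesis"
    then have "shift i j F = F" unfolding shift_def by auto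
    then show False using ne by simp
  qed
  then have "\<exists>A\<in>F. \<Sum> (shift_set i j F A) < \<Sum> A"
    by (metis less shift_set_def)
  then have "(\<Sum>A\<in>F. \<Sum> (shift_set i j F A)) < (\<Sum>A\<in>F. \<Sum>A)"
    using le by (rule_tac sum_strict_mono_ex1[OF F(2)]) simp_all
  then show ?thesis unfolding shift_def by (simp add: sum.reindex[OF inj_on_shift_set])
qed

lemma shift_fixedD:
  assumes "shift i j F = F" "A \<in> F" "j \<in> A" "i \<notin> A"
  shows "insert i (A - {j}) \<in> F"
proof (rule ccontr)
  assume "insert i (A - {j}) \<notin> F"
  moreover from this have "shift_set i j F A = insert i (A - {j})"
    using assms unfolding shift_set_def by simp
  ultimately show False using assms unfolding shift_def by (metis imageI)
qed

text \<open>The obstruction to a shift: when it fails, at least half of \<open>F\<close> misses both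
  elements, so \<open>i\<close> has degree at most \<open>card F / 2\<close> after the
  shift.\<close>

definition dominating_pair :: "nat set set \<Rightarrow> nat \<Rightarrow> nat \<Rightarrow> bool" where
  "dominating_pair F i j \<longleftrightarrow> 2 * card {A \<in> F. i \<notin> A \<and> j \<notin> A} < card F"

definition stuck :: "nat set \<Rightarrow> nat set set \<Rightarrow> bool" where
  "stuck X F \<longleftrightarrow> (\<forall>i\<in>X. \<forall>j\<in>X. i < j \<longrightarrow> shift i j F = F \<or> dominating_pair F i j)"

text \<open>Shift non-dominating pairs as long as this changes the family; the sum of all elements
  drops each time. In the applications \<open>P\<close> states that the family is a counterexample
  to the claim at hand.\<close>

lemma shift_until_stuck:
  assumes X: "finite X" and F: "F \<subseteq> nsets X k" "intersecting F" "P F"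
    and step: "\<And>F i j. \<lbrakk>F \<subseteq> nsets X k; intersecting F; P F; i \<in> X; j \<in> X; i < j; \<not> dominating_pair F i j\<rbrakk>
       \<Longrightarrow> P (shift i j F)"
  shows "\<exists>G. G \<subseteq> nsets X k \<and> intersecting G \<and> P G \<and> stuck X G \<and> card G = card F"
  using F
proof (induction "\<Sum>A\<in>F. \<Sum>A" arbitrary: F rule: less_induct)
  case less
  show ?case
  proof (cases "stuck X F")
    case True
    then show ?thesis using less.prems by blast
  next
    case False
    then obtain i j where ij: "i \<in> X" "j \<in> X" "i < j" "shift i j F \<noteq> F" "\<not> dominating_pair F i j"
      unfolding stuck_def by blast
    have "finite F" using less.prems X finite_nsets finite_subset by metis
    then have "\<exists>G. G \<subseteq> nsets X k \<and> intersecting G \<and> P G \<and> stuck X G \<and> card G = card (shift i j F)"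
      using less.prems ij step shift_subset_nsets intersecting_shift sum_shift_less
      by (intro less.hyps) (metis nat_neq_iff)+
    then show ?thesis by (simp add: card_shift)
  qed
qed

text \<open>Common elements of \<open>A\<close> and \<open>B\<close> in \<open>R\<close> are replaced, smallest first, by smaller elements of
  \<open>R\<close> outside both; this preserves the counting condition.\<close>
lemma shift_away:
  assumes R: "finite R"
    and stable: "\<And>B i j. \<lbrakk>B \<in> F; i \<in> R; j \<in> R; i < j; j \<in> B; i \<notin> B\<rbrakk> \<Longrightarrow> insert i (B - {j}) \<in> F"
    and B: "B \<in> F"
    and le: "\<And>v. v \<in> R \<Longrightarrow> card (A \<inter> seg R v) + card (B \<inter> seg R v) \<le> card (seg R v)"
  shows "\<exists>B'\<in>F. B' - R = B - R \<and> A \<inter> B' \<inter> R = {}"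
  using B le
proof (induction "card (A \<inter> B \<inter> R)" arbitrary: B rule: less_induct)
  case less
  show ?case
  proof (cases "A \<inter> B \<inter> R = {}")
    case True
    then show ?thesis using less.prems by blast
  next
    case False
    define v where "v = Min (A \<inter> B \<inter> R)"
    have "v \<in> A \<inter> B \<inter> R" unfolding v_def using False R by (intro Min_in) auto
    then have v: "v \<in> A" "v \<in> B" "v \<in> R" by auto
    have vmin: "v \<le> w" if "w \<in> A" "w \<in> B" "w \<in> R" for w
      unfolding v_def using that R by (intro Min_le) auto
    \<comment> \<open>The common element \<open>v\<close> is counted twice in the condition at
      \<open>v\<close>, so \<open>A\<close> and \<open>B\<close> cannot cover the whole
      segment.\<close>
    have "\<exists>u\<in>seg R v. u \<notin> A \<and> u \<notin> B"
    proof (rule ccontr)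
      assume "\<not> ?thesis"
      then have "(A \<inter> seg R v) \<union> (B \<inter> seg R v) = seg R v" by auto
      then have "card ((A \<inter> seg R v) \<union> (B \<inter> seg R v)) = card (seg R v)" by (rule arg_cong)
      moreover have "card ((A \<inter> seg R v) \<union> (B \<inter> seg R v)) + card ((A \<inter> seg R v) \<inter> (B \<inter> seg R v))
          = card (A \<inter> seg R v) + card (B \<inter> seg R v)"
        using R by (intro card_Un_Int[symmetric]) auto
      moreover have "card ((A \<inter> seg R v) \<inter> (B \<inter> seg R v)) > 0"
        using R v by (subst card_gt_0_iff) auto
      ultimately show False using less.prems(2)[OF v(3)] by linarith
    qed
    then obtain u where u: "u \<in> R" "u \<le> v" "u \<notin> A" "u \<notin> B" by auto
    then have "u < v" using v(1) by (cases "u = v") auto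
    define B' where "B' = insert u (B - {v})"
    have B'F: "B' \<in> F" unfolding B'_def using stable less.prems u v \<open>u < v\<close> by blast
    have "A \<inter> B' \<inter> R = (A \<inter> B \<inter> R) - {v}" unfolding B'_def using u(3) by auto
    then have smaller: "card (A \<inter> B' \<inter> R) < card (A \<inter> B \<inter> R)"
      using R v by (simp only:) (intro card_Diff1_less, auto)
    have "card (A \<inter> seg R w) + card (B' \<inter> seg R w) \<le> card (seg R w)" if w: "w \<in> R" for w
    proof (cases "w < v")
      case True
      \<comment> \<open>The new element \<open>u\<close> may raise the count below \<open>v\<close>,
        but there the two sets are disjoint by minimality of \<open>v\<close>.\<close>
      have "(A \<inter> seg R w) \<inter> (B' \<inter> seg R w) = {}"
      proof -
        have False if "x \<in> A" "x \<in> B'" "x \<in> R" "x \<le> w" for x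
        proof (cases "x = u")
          case False
          then show ?thesis using that vmin[of x] True unfolding B'_def by auto
        qed (use u that in auto)
        then show ?thesis by blast
      qed
      then have "card (A \<inter> seg R w) + card (B' \<inter> seg R w) = card ((A \<inter> seg R w) \<union> (B' \<inter> seg R w))"
        using R by (intro card_Un_disjoint[symmetric]) auto
      also have "\<dots> \<le> card (seg R w)" using R by (intro card_mono) auto
      finally show ?thesis .
    next
      case False
      then have "u \<le> w" "v \<le> w" using \<open>u < v\<close> by auto
      then have "B' \<inter> seg R w = insert u ((B \<inter> seg R w) - {v})" "v \<in> B \<inter> seg R w" "u \<notin> B \<inter> seg R w"
        unfolding B'_def using u(1,4) v \<open>u < v\<close> by auto
      then have "card (B' \<inter> seg R w) = card (B \<inter> seg R w)"
      proof -
        have "card (insert u (B \<inter> seg R w - {v})) = Suc (card (B \<inter> seg R w - {v}))"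
          using R \<open>u \<notin> B \<inter> seg R w\<close> by (intro card_insert_disjoint) auto
        then show ?thesis
          using R card.remove[of "B \<inter> seg R w" v] \<open>v \<in> B \<inter> seg R w\<close>
            \<open>B' \<inter> seg R w = insert u ((B \<inter> seg R w) - {v})\<close> by (metis finite_Int)
      qed
      then show ?thesis using less.prems(2)[OF w] by simp
    qed
    then have "\<exists>B''\<in>F. B'' - R = B' - R \<and> A \<inter> B'' \<inter> R = {}"
      using less.hyps[OF smaller B'F] by blast
    moreover have "B' - R = B - R" unfolding B'_def using u v by auto
    ultimately show ?thesis by simp
  qed
qed

section \<open>Families in which every further shift is blocked\<close>

text \<open>Dominating pairs as unordered edges, so that a matching is a pairwise disjoint
  subset.\<close>

definition dom_pairs :: "nat set \<Rightarrow> nat set set \<Rightarrow> nat set set" where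
  "dom_pairs X F = {e. e \<subseteq> X \<and> card e = 2 \<and> 2 * card {A \<in> F. A \<inter> e = {}} < card F}"

lemma card_edges_met_le:
  assumes "finite M" "pairwise disjnt M" "\<And>e. e \<in> M \<Longrightarrow> finite e"
  shows "card {e \<in> M. A \<inter> e \<noteq> {}} \<le> card (A \<inter> \<Union>M)"
proof -
  have "card {e \<in> M. A \<inter> e \<noteq> {}} = (\<Sum>e\<in>{e \<in> M. A \<inter> e \<noteq> {}}. 1)" by simp
  also have "\<dots> \<le> (\<Sum>e\<in>{e \<in> M. A \<inter> e \<noteq> {}}. card (A \<inter> e))"
  proof (rule sum_mono)
    fix e assume "e \<in> {e \<in> M. A \<inter> e \<noteq> {}}"
    then have "card (A \<inter> e) \<noteq> 0" using assms by (auto simp: card_eq_0_iff)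
    then show "1 \<le> card (A \<inter> e)" by simp
  qed
  also have "\<dots> \<le> (\<Sum>e\<in>M. card (A \<inter> e))"
    using assms by (intro sum_mono2) auto
  also have "\<dots> = card (\<Union>e\<in>M. A \<inter> e)"
    using assms unfolding pairwise_def disjnt_def by (intro card_UN_disjoint[symmetric] ballI impI) blast+
  also have "(\<Union>e\<in>M. A \<inter> e) = A \<inter> \<Union>M" by auto
  finally show ?thesis .
qed

text \<open>On average a member of \<open>F\<close> meets more than three of six pairwise disjoint dominating pairs,
  so a quarter of \<open>F\<close> meets at least three of them; but few \<open>k\<close>-sets do.\<close>
lemma card_le_if_six_dom_pairs:
  assumes X: "finite X" and F: "F \<subseteq> nsets X k"
    and M: "M \<subseteq> dom_pairs X F" "pairwise disjnt M" "card M = 6"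
  shows "real (card F) \<le> 880 * ((real k / real (card X)) ^ 3 * real (card X choose k))"
proof -
  have finF: "finite F" using F X finite_nsets finite_subset by metis
  have finM: "finite M" using M(3) by (metis card.infinite zero_neq_numeral)
  have e: "e \<subseteq> X" "card e = 2" "finite e" if "e \<in> M" for e
  proof -
    show "e \<subseteq> X" "card e = 2" using that M(1) unfolding dom_pairs_def by auto
    then show "finite e" using X finite_subset by blast
  qed
  define c where "c A = card {e \<in> M. A \<inter> e \<noteq> {}}" for A
  define N where "N = card {A \<in> F. 3 \<le> c A}"
  have meet: "card F + 1 \<le> 2 * card {A \<in> F. A \<inter> e \<noteq> {}}" if "e \<in> M" for e
  proof -
    have "card F = card ({A \<in> F. A \<inter> e \<noteq> {}} \<union> {A \<in> F. A \<inter> e = {}})"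
      by (rule arg_cong[where f = card]) auto
    also have "\<dots> = card {A \<in> F. A \<inter> e \<noteq> {}} + card {A \<in> F. A \<inter> e = {}}"
      using finF by (intro card_Un_disjoint) auto
    finally show ?thesis using that M(1) unfolding dom_pairs_def by auto
  qed
  have "6 * (card F + 1) = (\<Sum>e\<in>M. card F + 1)" using M by simp
  also have "\<dots> \<le> (\<Sum>e\<in>M. 2 * card {A \<in> F. A \<inter> e \<noteq> {}})"
    using meet by (rule sum_mono)
  also have "\<dots> = 2 * (\<Sum>e\<in>M. \<Sum>A\<in>{A \<in> F. A \<inter> e \<noteq> {}}. 1)"
    by (simp add: sum_distrib_left)
  also have "(\<Sum>e\<in>M. \<Sum>A\<in>{A \<in> F. A \<inter> e \<noteq> {}}. 1) = (\<Sum>A\<in>F. \<Sum>e\<in>{e \<in> M. A \<inter> e \<noteq> {}}. 1 :: nat)"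
    using finM finF by (rule sum.swap_restrict)
  also have "\<dots> = (\<Sum>A\<in>F. c A)" unfolding c_def by simp
  finally have lower: "6 * (card F + 1) \<le> 2 * (\<Sum>A\<in>F. c A)" .
  \<comment> \<open>A set meeting at most two pairs contributes at most 2, any other at most 6.
    Hence \<open>6 * (card F + 1) \<le> 4 * card F + 8 * N\<close>.\<close>
  have "(\<Sum>A\<in>F. c A) \<le> (\<Sum>A\<in>F. 2 + (if 3 \<le> c A then 4 else 0))"
  proof (rule sum_mono)
    fix A
    have "c A \<le> card M" unfolding c_def using finM by (intro card_mono) auto
    then show "c A \<le> 2 + (if 3 \<le> c A then 4 else 0)" using M(3) by simp
  qed
  also have "\<dots> = 2 * card F + 4 * N"
    using finF unfolding N_def
    by (simp only: sum.distrib sum_constant) (simp add: sum.inter_filter[symmetric])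
  finally have "card F \<le> 4 * N" using lower by presburger
  then have F_le: "real (card F) \<le> 4 * real N" by linarith
  have "card (\<Union>M) = (\<Sum>e\<in>M. card e)"
    by (rule card_Union_disjoint[OF M(2) e(3)])
  also have "\<dots> = 12" using e M(3) by simp
  finally have twelve: "card (\<Union>M) = 12" .
  have "{A \<in> F. 3 \<le> c A} \<subseteq> {A \<in> nsets X k. 3 \<le> card (A \<inter> \<Union>M)}"
    using F card_edges_met_le[OF finM M(2) e(3)] unfolding c_def by (auto intro: order_trans)
  then have "N \<le> card {A \<in> nsets X k. 3 \<le> card (A \<inter> \<Union>M)}"
    unfolding N_def using X by (intro card_mono) (auto simp: finite_nsets)
  then have "real N \<le> real (card {A \<in> nsets X k. 3 \<le> card (A \<inter> \<Union>M)})" by simp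
  also have "\<dots> \<le> real (12 choose 3) * ((real k / real (card X)) ^ 3 * real (card X choose k))"
    using card_nsets_meeting_ge[of X "\<Union>M" k 3] X e(1) twelve by auto
  \<comment> \<open>The constant 880 is \<open>4 * 220\<close>.\<close>
  also have "(12 choose 3) = (220 :: nat)" by (simp add: numeral_eq_Suc)
  finally show ?thesis using F_le by simp
qed

text \<open>\<open>T\<close> is the vertex set of a maximum matching of dominating pairs. It has at
  most five edges by the preceding lemma, and a dominating pair disjoint from \<open>T\<close> would
  enlarge it.\<close>

lemma exists_small_cover:
  assumes X: "finite X" and F: "F \<subseteq> nsets X k"
    and large: "880 * ((real k / real (card X)) ^ 3 * real (card X choose k)) < real (card F)"
  obtains T where "T \<subseteq> X" "card T \<le> 10"
    "\<And>i j. i \<in> X - T \<Longrightarrow> j \<in> X - T \<Longrightarrow> i \<noteq> j \<Longrightarrow> \<not> dominating_pair F i j"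
proof -
  define MM where "MM = {M. M \<subseteq> dom_pairs X F \<and> pairwise disjnt M}"
  have finD: "finite (dom_pairs X F)"
    using X unfolding dom_pairs_def by (rule_tac finite_subset[of _ "Pow X"]) auto
  then have "finite MM" unfolding MM_def by (rule_tac finite_subset[of _ "Pow (dom_pairs X F)"]) auto
  moreover have "{} \<in> MM" unfolding MM_def by simp
  ultimately have "Max (card ` MM) \<in> card ` MM" by (intro Max_in) auto
  then obtain M where M: "M \<in> MM" "card M = Max (card ` MM)" by auto
  have max: "card M' \<le> card M" if "M' \<in> MM" for M'
    using that M \<open>finite MM\<close> by simp
  have finM: "finite M" using M(1) finD finite_subset unfolding MM_def by auto
  have e: "e \<subseteq> X" "card e = 2" if "e \<in> M" for e
    using that M(1) unfolding dom_pairs_def MM_def by auto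
  have "card M < 6"
  proof (rule ccontr)
    assume "\<not> card M < 6"
    then obtain M' where "M' \<subseteq> M" "card M' = 6"
      using obtain_subset_with_card_n[of 6 M] by auto
    moreover from this have "M' \<subseteq> dom_pairs X F" "pairwise disjnt M'"
      using M(1) pairwise_subset unfolding MM_def by auto
    ultimately show False using card_le_if_six_dom_pairs[OF X F, of M'] large by linarith
  qed
  have "card (\<Union>M) \<le> (\<Sum>e\<in>M. card e)" by (rule card_Union_le_sum_card)
  also have "\<dots> \<le> 10" using e \<open>card M < 6\<close> by simp
  finally have "card (\<Union>M) \<le> 10" .
  moreover have "\<Union>M \<subseteq> X" using e by auto
  moreover have "\<not> dominating_pair F i j" if ij: "i \<in> X - \<Union>M" "j \<in> X - \<Union>M" "i \<noteq> j" for i j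
  proof
    assume "dominating_pair F i j"
    moreover have "{A \<in> F. A \<inter> {i, j} = {}} = {A \<in> F. i \<notin> A \<and> j \<notin> A}" by auto
    ultimately have "{i, j} \<in> dom_pairs X F"
      using ij unfolding dominating_pair_def dom_pairs_def by simp
    then have "insert {i, j} M \<in> MM"
      using M(1) ij unfolding MM_def by (auto simp: pairwise_insert disjnt_def)
    moreover have "{i, j} \<notin> M" using ij by auto
    ultimately show False using max[of "insert {i, j} M"] finM by simp
  qed
  ultimately show thesis by (intro that)
qed

text \<open>Without a common element all members are edges. An edge \<open>{a, b}\<close>, one
  avoiding \<open>a\<close> and one avoiding \<open>b\<close> form a triangle, and a set meeting all
  three sides contains two of its vertices.\<close>

lemma intersecting_small_sets_structure:
  assumes int: "intersecting T" and small: "\<And>t. t \<in> T \<Longrightarrow> finite t \<and> card t \<le> 2" and "T \<noteq> {}"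
  obtains x where "\<And>t. t \<in> T \<Longrightarrow> x \<in> t" "x \<in> \<Union>T"
  | W where "card W = 3" "W \<subseteq> \<Union>T" "\<And>t. t \<in> T \<Longrightarrow> 2 \<le> card (t \<inter> W)"
proof (cases "\<exists>x\<in>\<Union>T. \<forall>t\<in>T. x \<in> t")
  case True
  then show ?thesis using that(1) by blast
next
  case False
  have meet: "s \<inter> t \<noteq> {}" if "s \<in> T" "t \<in> T" for s t
    using that int unfolding intersecting_def by blast
  have two: "\<exists>a b. t = {a, b} \<and> a \<noteq> b" if "t \<in> T" for t
  proof -
    have "t \<noteq> {}" using meet[OF that that] by auto
    then have "card t \<noteq> 0" using small[OF that] by auto
    moreover have "card t \<noteq> 1"
    proof
      assume "card t = 1"
      then obtain x where "t = {x}" by (auto simp: card_1_singleton_iff)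
      then have "\<forall>s\<in>T. x \<in> s" using meet[OF that] by auto
      then show False using False that \<open>t = {x}\<close> by blast
    qed
    ultimately have "card t = 2" using small[OF that] by linarith
    then show ?thesis by (auto simp: card_2_iff)
  qed
  obtain t where t: "t \<in> T" using \<open>T \<noteq> {}\<close> by blast
  then obtain a b where ab: "t = {a, b}" "a \<noteq> b" using two by blast
  obtain s where s: "s \<in> T" "a \<notin> s" using False t ab by blast
  then have "b \<in> s" using meet[OF t s(1)] ab by auto
  then obtain c where c: "s = {b, c}" "b \<noteq> c" using two[OF s(1)] by auto
  obtain u where u: "u \<in> T" "b \<notin> u" using False t ab by blast
  then have "a \<in> u" "c \<in> u" using meet[OF t u(1)] meet[OF s(1) u(1)] ab c by auto
  moreover have "a \<noteq> c" using s c by auto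
  ultimately have uac: "u = {a, c}" using two[OF u(1)] by auto
  have "2 \<le> card (r \<inter> {a, b, c})" if "r \<in> T" for r
  proof -
    have "r \<inter> {a, b} \<noteq> {}" "r \<inter> {b, c} \<noteq> {}" "r \<inter> {a, c} \<noteq> {}"
      using meet[OF that t] meet[OF that s(1)] meet[OF that u(1)] ab c uac by auto
    then have "{a, b} \<subseteq> r \<inter> {a, b, c} \<or> {b, c} \<subseteq> r \<inter> {a, b, c} \<or> {a, c} \<subseteq> r \<inter> {a, b, c}"
      by auto
    moreover have "2 = card {a, b}" "2 = card {b, c}" "2 = card {a, c}"
      using ab c \<open>a \<noteq> c\<close> by auto
    ultimately show ?thesis
      by (metis card_mono finite.emptyI finite.insertI finite_Int)
  qed
  moreover have "card {a, b, c} = 3" using ab c \<open>a \<noteq> c\<close> by simp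
  moreover have "{a, b, c} \<subseteq> \<Union>T" using t s ab c by auto
  ultimately show ?thesis using that(2) by blast
qed

section \<open>Initial segments and the structure of stuck families\<close>

lemma obtain_initial_segment:
  fixes R :: "nat set"
  assumes "finite R" "m \<le> card R"
  obtains I where "I \<subseteq> R" "card I = m" "\<And>x y. x \<in> I \<Longrightarrow> y \<in> R - I \<Longrightarrow> x < y"
proof -
  have "\<exists>I\<subseteq>R. card I = m \<and> (\<forall>x\<in>I. \<forall>y\<in>R - I. x < y)"
    using assms(2)
  proof (induction m)
    case 0
    then show ?case by (intro exI[of _ "{}"]) auto
  next
    case (Suc m)
    then obtain I where I: "I \<subseteq> R" "card I = m" "\<forall>x\<in>I. \<forall>y\<in>R - I. x < y" by auto
    have "finite I" using I assms finite_subset by blast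
    have "R - I \<noteq> {}" using Suc.prems I card_mono[OF \<open>finite I\<close>, of R] by auto
    define y where "y = Min (R - I)"
    have y: "y \<in> R - I" unfolding y_def using assms \<open>R - I \<noteq> {}\<close> by (intro Min_in) auto
    have "y < z" if "z \<in> R - I" "z \<noteq> y" for z
      using Min_le[OF _ that(1)] that(2) assms(1) unfolding y_def by (simp add: le_neq_implies_less)
    then have "\<forall>x\<in>insert y I. \<forall>z\<in>R - insert y I. x < z" using I by auto
    moreover have "card (insert y I) = Suc m" using y I \<open>finite I\<close> by simp
    ultimately show ?case using y I by (intro exI[of _ "insert y I"]) auto
  qed
  then show thesis using that by blast
qed

lemma seg_in_initial:
  assumes I: "\<And>x y. x \<in> I \<Longrightarrow> y \<in> R - I \<Longrightarrow> x < y" and v: "v \<in> I"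
  shows "seg R v \<subseteq> I"
proof
  fix x assume "x \<in> seg R v"
  then show "x \<in> I" using I[OF v, of x] by (cases "x \<in> I") auto
qed

lemma seg_after_initial:
  assumes "I \<subseteq> R" and I: "\<And>x y. x \<in> I \<Longrightarrow> y \<in> R - I \<Longrightarrow> x < y" and v: "v \<in> R - I"
  shows "seg R v = I \<union> seg (R - I) v"
proof -
  have "x \<le> v" if "x \<in> I" for x using I[OF that v] by simp
  then show ?thesis using \<open>I \<subseteq> R\<close> by auto
qed

text \<open>\<open>U\<close> consists of the exceptional elements \<open>T\<close> and the six
  smallest others. \<open>G\<close> collects the members with trace at most two on \<open>U\<close>
  that are not overfull beyond it. Two members of \<open>G\<close> with disjoint traces could be
  shifted apart, so the traces intersect and form a star or lie on a triangle; \<open>F - G\<close>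
  is the error.\<close>

lemma stuck_family_structure:
  assumes X: "finite X" and F: "F \<subseteq> nsets X k" "intersecting F" "stuck X F"
    and k: "1 \<le> k" "16 * k \<le> card X"
    and large: "880 * ((real k / real (card X)) ^ 3 * real (card X choose k)) < real (card F)"
  obtains R where "R \<subseteq> X" "card (X - R) \<le> 10"
    "\<And>B i j. \<lbrakk>B \<in> F; i \<in> R; j \<in> R; i < j; j \<in> B; i \<notin> B\<rbrakk> \<Longrightarrow> insert i (B - {j}) \<in> F"
    "(\<exists>x\<in>X. real (card {A \<in> F. x \<notin> A})
         \<le> 576 * ((real k / real (card X)) ^ 3 * real (card X choose k))) \<or>
     (\<exists>W\<subseteq>X. card W = 3 \<and> real (card {A \<in> F. card (A \<inter> W) < 2})
         \<le> 576 * ((real k / real (card X)) ^ 3 * real (card X choose k)))"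
proof -
  define M3 where "M3 = (real k / real (card X)) ^ 3 * real (card X choose k)"
  have finF: "finite F" using F X finite_nsets finite_subset by metis
  obtain T where T: "T \<subseteq> X" "card T \<le> 10"
    "\<And>i j. i \<in> X - T \<Longrightarrow> j \<in> X - T \<Longrightarrow> i \<noteq> j \<Longrightarrow> \<not> dominating_pair F i j"
    using exists_small_cover[OF X F(1) large] by blast
  define R where "R = X - T"
  have R: "R \<subseteq> X" "X - R = T" "finite R" using T X unfolding R_def by auto
  have stable: "insert i (B - {j}) \<in> F"
    if "B \<in> F" "i \<in> R" "j \<in> R" "i < j" "j \<in> B" "i \<notin> B" for B i j
  proof -
    have "\<not> dominating_pair F i j" using T(3) that unfolding R_def by auto
    then have "shift i j F = F" using F(3) that R unfolding stuck_def by blast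
    then show ?thesis using shift_fixedD that by metis
  qed
  have "6 \<le> card R" 
    using k T(2) card_Diff_subset[OF finite_subset[OF T(1) X] T(1)] unfolding R_def by simp
  \<comment> \<open>Six pays for two traces of size two and for an excess of at most one over half
    of the later segment in each of the two sets.\<close>
  then obtain I where I: "I \<subseteq> R" "card I = 6" "\<And>x y. x \<in> I \<Longrightarrow> y \<in> R - I \<Longrightarrow> x < y"
    using obtain_initial_segment[OF R(3)] by metis
  define U where "U = T \<union> I"
  define R' where "R' = R - I"
  have U: "U \<subseteq> X" "card U \<le> 16" 
    using T(1,2) I(1,2) R(1) card_Un_le[of T I] unfolding U_def by auto
  have finU: "finite U" using U X finite_subset by blast
  define G where "G = {A \<in> F. card (A \<inter> U) \<le> 2 \<and> \<not> overfull R' 3 A}"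
  have "F - G \<subseteq> {A \<in> nsets X k. card (A \<inter> U) \<ge> 3} \<union> {A \<in> nsets X k. overfull R' 3 A}"
    using F(1) unfolding G_def by auto
  then have "card (F - G) \<le> card ({A \<in> nsets X k. card (A \<inter> U) \<ge> 3} \<union> {A \<in> nsets X k. overfull R' 3 A})"
    using X by (intro card_mono) (auto simp: finite_nsets)
  also have "\<dots> \<le> card {A \<in> nsets X k. card (A \<inter> U) \<ge> 3} + card {A \<in> nsets X k. overfull R' 3 A}"
    by (rule card_Un_le)
  finally have "real (card (F - G)) \<le> real (card {A \<in> nsets X k. card (A \<inter> U) \<ge> 3})
      + real (card {A \<in> nsets X k. overfull R' 3 A})" by linarith
  moreover have "real (card {A \<in> nsets X k. card (A \<inter> U) \<ge> 3}) \<le> 560 * M3"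
  proof -
    have "card U choose 3 \<le> 16 choose 3" using U(2) by (rule binomial_right_mono)
    also have "\<dots> = 560" by (simp add: numeral_eq_Suc)
    finally have "real (card U choose 3) * M3 \<le> 560 * M3"
      unfolding M3_def by (intro mult_right_mono) auto
    then show ?thesis using card_nsets_meeting_ge[OF X U(1), of k 3] unfolding M3_def by linarith
  qed
  moreover have "real (card {A \<in> nsets X k. overfull R' 3 A}) \<le> 16 * M3"
  proof -
    have "R' \<subseteq> X" using R unfolding R'_def by auto
    from card_overfull_le[OF X this k(2), of 3] show ?thesis
      unfolding M3_def by (simp only: power_mult_distrib) simp
  qed
  \<comment> \<open>The constant 576 is \<open>(16 choose 3) + 2 * 2 ^ 3\<close>.\<close>
  ultimately have rest: "real (card (F - G)) \<le> 576 * M3" by linarith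
  have small_le: "real (card {A \<in> F. Q A}) \<le> 576 * M3" if "\<And>A. A \<in> G \<Longrightarrow> \<not> Q A" for Q
  proof -
    have "card {A \<in> F. Q A} \<le> card (F - G)"
      using that finF by (intro card_mono) auto
    then show ?thesis using rest by linarith
  qed
  have meetU: "A \<inter> B \<inter> U \<noteq> {}" if "A \<in> G" "B \<in> G" for A B
  proof
    assume disj: "A \<inter> B \<inter> U = {}"
    have A: "A \<in> F" "card (A \<inter> U) \<le> 2" "\<not> overfull R' 3 A"
      and B: "B \<in> F" "card (B \<inter> U) \<le> 2" "\<not> overfull R' 3 B"
      using that unfolding G_def by auto
    have "card (A \<inter> seg R v) + card (B \<inter> seg R v) \<le> card (seg R v)" if v: "v \<in> R" for v
    proof (cases "v \<in> I")
      case True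
      have "seg R v \<subseteq> I" using seg_in_initial[OF I(3) True] .
      then have "(A \<inter> seg R v) \<inter> (B \<inter> seg R v) = {}" using disj unfolding U_def by blast
      then have "card (A \<inter> seg R v) + card (B \<inter> seg R v) = card ((A \<inter> seg R v) \<union> (B \<inter> seg R v))"
        using R by (intro card_Un_disjoint[symmetric]) auto
      also have "\<dots> \<le> card (seg R v)" using R by (intro card_mono) auto
      finally show ?thesis .
    next
      case False
      then have v': "v \<in> R'" using v unfolding R'_def by auto
      have eq: "seg R v = I \<union> seg R' v"
        unfolding R'_def using seg_after_initial[OF I(1,3)] v' unfolding R'_def by simp
      have "card (seg R v) = card I + card (seg R' v)"
        unfolding eq using R(3) finite_subset[OF I(1) R(3)] unfolding R'_def
        by (intro card_Un_disjoint) auto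
      moreover have "card (Y \<inter> seg R v) \<le> card (Y \<inter> U) + card (Y \<inter> seg R' v)" for Y
      proof -
        have "card (Y \<inter> seg R v) \<le> card ((Y \<inter> U) \<union> (Y \<inter> seg R' v))"
          using finU R unfolding eq U_def R'_def by (intro card_mono) auto
        also have "\<dots> \<le> card (Y \<inter> U) + card (Y \<inter> seg R' v)" by (rule card_Un_le)
        finally show ?thesis .
      qed
      from this[of A] this[of B] have "card (A \<inter> seg R v) \<le> card (A \<inter> U) + card (A \<inter> seg R' v)"
        "card (B \<inter> seg R v) \<le> card (B \<inter> U) + card (B \<inter> seg R' v)" .
      moreover have "2 * card (A \<inter> seg R' v) < card (seg R' v) + 3"
        "2 * card (B \<inter> seg R' v) < card (seg R' v) + 3"
        using A(3) B(3) v' unfolding overfull_def by (auto simp: not_le)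
      ultimately show ?thesis using A(2) B(2) I(2) by linarith
    qed
    then obtain B' where B': "B' \<in> F" "B' - R = B - R" "A \<inter> B' \<inter> R = {}"
      using shift_away[OF R(3) stable B(1), of A] by blast
    have "B' \<subseteq> X" using B'(1) F(1) by (auto simp: nsets_def)
    \<comment> \<open>Outside \<open>R\<close>, that is on \<open>T\<close>, the set
      \<open>B'\<close> still agrees with \<open>B\<close>.\<close>
    then have "A \<inter> B' \<subseteq> A \<inter> B \<inter> T" using B' unfolding R_def by blast
    then have "A \<inter> B' = {}" using disj unfolding U_def by blast
    then show False using F(2) A(1) B'(1) unfolding intersecting_def by blast
  qed
  have "(\<exists>x\<in>X. real (card {A \<in> F. x \<notin> A}) \<le> 576 * M3) \<or>
     (\<exists>W\<subseteq>X. card W = 3 \<and> real (card {A \<in> F. card (A \<inter> W) < 2}) \<le> 576 * M3)"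
  proof (cases "G = {}")
    case True
    \<comment> \<open>All of \<open>F\<close> is exceptional here, so any element serves as the
      centre of a star.\<close>
    have "X \<noteq> {}" using k by auto
    then obtain x where "x \<in> X" by blast
    moreover have "real (card {A \<in> F. x \<notin> A}) \<le> 576 * M3"
      by (rule small_le) (simp add: True)
    ultimately show ?thesis by blast
  next
    case False
    define TT where "TT = (\<lambda>A. A \<inter> U) ` G"
    have "intersecting TT" unfolding intersecting_def TT_def using meetU by blast
    moreover have "finite t \<and> card t \<le> 2" if "t \<in> TT" for t
      using that finU unfolding TT_def G_def by auto
    moreover have "TT \<noteq> {}" using False unfolding TT_def by simp
    moreover have TTU: "\<Union>TT \<subseteq> U" unfolding TT_def by auto
    ultimately consider (star) x where "\<And>t. t \<in> TT \<Longrightarrow> x \<in> t" "x \<in> \<Union>TT"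
      | (triangle) W where "card W = 3" "W \<subseteq> \<Union>TT" "\<And>t. t \<in> TT \<Longrightarrow> 2 \<le> card (t \<inter> W)"
      using intersecting_small_sets_structure[of TT] by blast
    then show ?thesis
    proof cases
      case star
      have "x \<in> A" if "A \<in> G" for A using star(1)[of "A \<inter> U"] that unfolding TT_def by auto
      then have "real (card {A \<in> F. x \<notin> A}) \<le> 576 * M3" by (intro small_le) simp
      then show ?thesis using star(2) TTU U(1) by blast
    next
      case triangle
      have "\<not> card (A \<inter> W) < 2" if "A \<in> G" for A
      proof -
        have "A \<inter> U \<inter> W = A \<inter> W" using triangle(2) TTU by blast
        then show ?thesis using triangle(3)[of "A \<inter> U"] that unfolding TT_def by auto
      qed
      then have "real (card {A \<in> F. card (A \<inter> W) < 2}) \<le> 576 * M3" by (intro small_le) simp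
      moreover have "W \<subseteq> X" using triangle(2) TTU U(1) by blast
      ultimately show ?thesis using triangle(1) by blast
    qed
  qed
  moreover have "card (X - R) \<le> 10" using R T by simp
  ultimately show thesis using that[OF R(1) _ stable] unfolding M3_def by blast
qed

section \<open>An element contained in more than half of the sets\<close>

text \<open>A family of density \<open>O(p^3)\<close> has size only \<open>O(p) * \<beta>\<close>,
  which is negligible for a large constant.\<close>

lemma cube_binomial_le:
  assumes "2 \<le> k" "8 * k \<le> n"
  shows "(real k / real n) ^ 3 * real (n choose k)
    \<le> 4 * (real k / real n) * real ((n - 3) choose (k - 2))"
proof -
  have "(real k / real n) * ((real k / real n)\<^sup>2 * real (n choose k))
      \<le> (real k / real n) * (4 * real ((n - 3) choose (k - 2)))"
    using binomial_le_sq_binomial[OF assms] by (intro mult_left_mono) auto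
  then show ?thesis by (simp add: power3_eq_cube power2_eq_square algebra_simps)
qed

lemma sum_degree:
  assumes "finite F" "finite W"
  shows "(\<Sum>x\<in>W. degree F x) = (\<Sum>A\<in>F. card (A \<inter> W))"
proof -
  have "(\<Sum>x\<in>W. degree F x) = (\<Sum>x\<in>W. \<Sum>A\<in>{A \<in> F. x \<in> A}. 1)"
    unfolding degree_def by simp
  also have "\<dots> = (\<Sum>A\<in>F. \<Sum>x\<in>{x \<in> W. x \<in> A}. 1)"
    using assms(2,1) by (rule sum.swap_restrict)
  also have "\<dots> = (\<Sum>A\<in>F. card (A \<inter> W))"
    by (intro sum.cong) (auto intro: arg_cong[where f = card])
  finally show ?thesis .
qed

text \<open>If all degrees are at most half, this survives shifting non-dominating pairs. In the
  stuck family a star centre would have degree near \<open>card G\<close>, and in the triangle case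
  the three degrees would sum to nearly \<open>2 * card G\<close>, more than the permitted
  \<open>3/2 * card G\<close>.\<close>

lemma exists_degree_gt_half:
  fixes X :: "nat set"
  assumes X: "finite X" and F: "F \<subseteq> nsets X k" "intersecting F"
    and k: "2 \<le> k" "10 ^ 5 * k \<le> card X"
    and large: "(card X - 3) choose (k - 2) \<le> card F"
  shows "\<exists>x\<in>X. card F < 2 * degree F x"
proof (rule ccontr)
  assume neg: "\<not> ?thesis"
  define P where "P G \<longleftrightarrow> card G = card F \<and> (\<forall>x\<in>X. 2 * degree G x \<le> card F)" for G
  have "P F" using neg unfolding P_def by (auto simp: not_less)
  have "P (shift i j G)"
    if G: "G \<subseteq> nsets X k" "P G" and ij: "i \<in> X" "\<not> dominating_pair G i j" for G i j
  proof -
    have finG: "finite G" using G X finite_nsets finite_subset by metis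
    have "2 * degree (shift i j G) x \<le> card F" if "x \<in> X" for x
    proof (cases "x = i")
      case True
      have "card G = card F" using G(2) unfolding P_def by blast
      then show ?thesis
        using degree_shift_self_le[OF finG, of i j] card_meeting_plus_missing[OF finG, of i j] ij(2)
        unfolding dominating_pair_def True by linarith
    next
      case False
      have "2 * degree G x \<le> card F" using G(2) that unfolding P_def by blast
      then show ?thesis using degree_shift_le[OF finG False, of j] by linarith
    qed
    then show ?thesis using G(2) unfolding P_def by (simp add: card_shift)
  qed
  then obtain G where G: "G \<subseteq> nsets X k" "intersecting G" "P G" "stuck X G"
    using shift_until_stuck[where P = P, OF X F \<open>P F\<close>] by blast
  have finG: "finite G" using G X finite_nsets finite_subset by metis
  have cG: "card G = card F" and degG: "\<And>x. x \<in> X \<Longrightarrow> 2 * degree G x \<le> card G"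
    using G(3) unfolding P_def by auto
  define p where "p = real k / real (card X)"
  define M3 where "M3 = p ^ 3 * real (card X choose k)"
  have "card X > 0" using k by (cases "card X") auto
  have "10 ^ 5 * real k \<le> real (card X)"
    using of_nat_mono[OF k(2), where ?'a = real] by simp
  then have p: "p \<le> 1 / 10 ^ 5" "0 \<le> p"
    using \<open>card X > 0\<close> unfolding p_def by (auto simp: divide_simps)
  have pos: "0 < (card X - 3) choose (k - 2)"
    using k by (intro zero_less_binomial) auto
  have "M3 \<le> 4 * p * real ((card X - 3) choose (k - 2))"
    unfolding M3_def p_def using k by (intro cube_binomial_le) auto
  also have "\<dots> \<le> 4 * (1 / 10 ^ 5) * real (card G)"
    using p large cG by (intro mult_mono) auto
  finally have M3: "M3 \<le> 4 / 10 ^ 5 * real (card G)" by simp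
  have Gpos: "0 < card G" using pos large cG by linarith
  have "880 * M3 < real (card G)" using M3 Gpos by simp
  then have large': "880 * ((real k / real (card X)) ^ 3 * real (card X choose k)) < real (card G)"
    unfolding M3_def p_def .
  have k': "1 \<le> k" "16 * k \<le> card X" using k by auto
  have "(\<exists>x\<in>X. real (card {A \<in> G. x \<notin> A}) \<le> 576 * M3) \<or>
     (\<exists>W\<subseteq>X. card W = 3 \<and> real (card {A \<in> G. card (A \<inter> W) < 2}) \<le> 576 * M3)"
    using stuck_family_structure[OF X G(1,2,4) k' large'] unfolding M3_def p_def by blast
  then show False
  proof (elim disjE bexE exE conjE)
    fix x assume x: "x \<in> X" "real (card {A \<in> G. x \<notin> A}) \<le> 576 * M3"
    have "2 * degree G x \<le> card G" "degree G x + card {A \<in> G. x \<notin> A} = card G"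
      using degG x degree_plus_missing[OF finG] by auto
    then have "real (card G) \<le> 2 * real (card {A \<in> G. x \<notin> A})" by linarith
    then show False using x(2) M3 Gpos by simp
  next
    fix W assume W: "W \<subseteq> X" "card W = 3" "real (card {A \<in> G. card (A \<inter> W) < 2}) \<le> 576 * M3"
    define a b where "a = card {A \<in> G. 2 \<le> card (A \<inter> W)}" and "b = card {A \<in> G. card (A \<inter> W) < 2}"
    have finW: "finite W" using W X finite_subset by blast
    have "card G = card ({A \<in> G. 2 \<le> card (A \<inter> W)} \<union> {A \<in> G. card (A \<inter> W) < 2})"
      by (rule arg_cong[where f = card]) auto
    also have "\<dots> = a + b" unfolding a_def b_def
      using finG by (intro card_Un_disjoint) auto
    finally have ab: "card G = a + b" .
    have "2 * a = (\<Sum>A\<in>{A \<in> G. 2 \<le> card (A \<inter> W)}. 2)" unfolding a_def by simp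
    also have "\<dots> \<le> (\<Sum>A\<in>{A \<in> G. 2 \<le> card (A \<inter> W)}. card (A \<inter> W))" by (intro sum_mono) auto
    also have "\<dots> \<le> (\<Sum>A\<in>G. card (A \<inter> W))" using finG by (intro sum_mono2) auto
    also have "\<dots> = (\<Sum>x\<in>W. degree G x)" by (rule sum_degree[OF finG finW, symmetric])
    finally have "4 * a \<le> (\<Sum>x\<in>W. 2 * degree G x)" by (simp flip: sum_distrib_left)
    also have "\<dots> \<le> (\<Sum>x\<in>W. card G)" using degG W by (intro sum_mono) auto
    finally have "4 * a \<le> 3 * card G" using W by simp
    then have "real (card G) \<le> 4 * real b" using ab by linarith
    then show False using W(3) M3 Gpos unfolding b_def by simp
  qed
qed

section \<open>Two-out-of-three families\<close>

definition two_of :: "'a set \<Rightarrow> 'a set set \<Rightarrow> bool" where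
  "two_of W F \<longleftrightarrow> (\<forall>A\<in>F. 2 \<le> card (A \<inter> W))"

text \<open>Missing \<open>x\<close> forces both other elements of \<open>W\<close>, leaving
  \<open>k - 2\<close> elements to choose outside \<open>W\<close>. This is where
  \<open>\<beta>\<close> comes from.\<close>

lemma two_of_missing_subset:
  assumes X: "finite X" and F: "F \<subseteq> nsets X k" "two_of W F" and W: "W \<subseteq> X" "card W = 3" "x \<in> W"
  shows "{A \<in> F. x \<notin> A} \<subseteq> (\<lambda>D. (W - {x}) \<union> D) ` nsets (X - W) (k - 2)"
proof
  fix A assume A: "A \<in> {A \<in> F. x \<notin> A}"
  have finW: "finite W" using W X finite_subset by blast
  then have c2: "card (W - {x}) = 2" using W by simp
  have "2 \<le> card (A \<inter> W)" using A F(2) unfolding two_of_def by blast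
  moreover have "A \<inter> W \<subseteq> W - {x}" using A by blast
  ultimately have AW: "A \<inter> W = W - {x}" using c2 finW by (metis card_seteq finite_Diff)
  have "A \<subseteq> X" "finite A" "card A = k" using A F(1) by (auto simp: nsets_def)
  moreover have "card (A - W) = card A - card (A \<inter> W)"
    using \<open>finite A\<close> by (simp add: card_Diff_subset_Int)
  ultimately have "A - W \<in> nsets (X - W) (k - 2)" using AW c2 by (auto simp: nsets_def)
  moreover have "A = (W - {x}) \<union> (A - W)" using AW by blast
  ultimately show "A \<in> (\<lambda>D. (W - {x}) \<union> D) ` nsets (X - W) (k - 2)" by blast
qed

lemma card_image_nsets_le:
  assumes "finite X" "W \<subseteq> X" "card W = 3"
  shows "finite (f ` nsets (X - W) m)" "card (f ` nsets (X - W) m) \<le> (card X - 3) choose m"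
proof -
  have "finite W" using assms finite_subset by blast
  then have "card (X - W) = card X - 3" using assms by (simp add: card_Diff_subset)
  then have "card (nsets (X - W) m) = (card X - 3) choose m"
    using assms by (simp add: card_nsets_eq)
  moreover have fin: "finite (nsets (X - W) m)" using assms by (simp add: finite_nsets)
  ultimately show "card (f ` nsets (X - W) m) \<le> (card X - 3) choose m"
    using card_image_le[OF fin, of f] by simp
  show "finite (f ` nsets (X - W) m)" using fin by simp
qed

lemma card_missing_two_of_le:
  assumes "finite X" "F \<subseteq> nsets X k" "two_of W F" "W \<subseteq> X" "card W = 3" "x \<in> W"
  shows "card {A \<in> F. x \<notin> A} \<le> (card X - 3) choose (k - 2)"
  using card_mono[OF card_image_nsets_le(1) two_of_missing_subset[OF assms]]
    card_image_nsets_le(2) assms by (meson order_trans)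

text \<open>If only shifting turns \<open>F\<close> into a two-out-of-three family, then the sets with exactly two
  elements in \<open>W\<close> are all present after the shift, and those through \<open>i\<close> come from sets through
  \<open>i\<close> or through \<open>j\<close>. Disjoint remainders must make the same choice, and Kneser graphs are
  connected, so the choice is uniform.\<close>
lemma two_of_shift_reverse:
  fixes X :: "nat set"
  assumes X: "finite X" and k: "2 \<le> k" "3 * k \<le> card X"
    and F: "F \<subseteq> nsets X k" "intersecting F" and ij: "i \<in> X" "j \<in> X" "i \<noteq> j"
    and W: "W \<subseteq> X" "card W = 3" and two: "two_of W (shift i j F)"
    and many: "\<And>x. x \<in> W \<Longrightarrow> (card X - 3) choose (k - 2) \<le> card {A \<in> shift i j F. x \<notin> A}"
  shows "\<exists>W'\<subseteq>X. card W' = 3 \<and> two_of W' F"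
proof (cases "two_of W F")
  case True
  then show ?thesis using W by blast
next
  case False
  let ?S = "shift i j F"
  have S: "?S \<subseteq> nsets X k" using shift_subset_nsets F ij by blast
  have finW: "finite W" using W X finite_subset by blast
  have full: "(W - {x}) \<union> D \<in> ?S" if "x \<in> W" "D \<in> nsets (X - W) (k - 2)" for x D
  proof -
    let ?I = "(\<lambda>D. (W - {x}) \<union> D) ` nsets (X - W) (k - 2)"
    \<comment> \<open>The inclusion is an equality because \<open>?I\<close> has at most as many
      elements as \<open>many\<close> guarantees on the left.\<close>
    have "{A \<in> ?S. x \<notin> A} = ?I"
      using card_image_nsets_le[OF X W, of "\<lambda>D. (W - {x}) \<union> D" "k - 2"] many[OF that(1)]
      by (intro card_seteq two_of_missing_subset[OF X S two W that(1)]) auto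
    then show ?thesis using that by blast
  qed
  from False obtain A0 where A0: "A0 \<in> F" "card (A0 \<inter> W) < 2"
    unfolding two_of_def by (auto simp: not_le)
  have finA0: "finite A0" "A0 \<subseteq> X" "card A0 = k" using A0 F(1) by (auto simp: nsets_def)
  have A0S: "shift_set i j F A0 \<in> ?S" using A0 unfolding shift_def by blast
  then have two0: "2 \<le> card (shift_set i j F A0 \<inter> W)" using two unfolding two_of_def by blast
  then have moved: "j \<in> A0" "i \<notin> A0" and two0: "2 \<le> card (insert i (A0 - {j}) \<inter> W)"
    using A0 unfolding shift_set_def by (auto split: if_splits)
  \<comment> \<open>Replacing \<open>j\<close> by \<open>i\<close> raised the trace of
    \<open>A0\<close> on \<open>W\<close> to two, so \<open>i\<close> lies in \<open>W\<close> and
    \<open>j\<close> does not.\<close>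
  have jW: "j \<notin> W"
  proof
    assume "j \<in> W"
    then have "{j} = A0 \<inter> W"
      using A0(2) moved finW by (intro card_seteq) auto
    then have "insert i (A0 - {j}) \<inter> W \<subseteq> {i}" by blast
    then have "card (insert i (A0 - {j}) \<inter> W) \<le> card {i}" by (intro card_mono) auto
    then show False using two0 by simp
  qed
  have iW: "i \<in> W"
  proof (rule ccontr)
    assume "i \<notin> W"
    then have "card (insert i (A0 - {j}) \<inter> W) \<le> card (A0 \<inter> W)"
      using finW by (intro card_mono) auto
    then show False using two0 A0(2) by simp
  qed
  have "insert i (A0 - {j}) \<inter> W = insert i (A0 \<inter> W)" using iW jW by auto
  then have "card (A0 \<inter> W) = 1" using two0 A0(2) moved(2) finW by simp
  then obtain y where y: "A0 \<inter> W = {y}" by (auto simp: card_1_singleton_iff)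
  have yi: "y \<in> W" "y \<noteq> i" "y \<in> A0" using y moved by auto
  have "card (W - {i, y}) = 1" using W iW yi finW by simp
  then obtain z where z: "W - {i, y} = {z}" by (auto simp: card_1_singleton_iff)
  have Weq: "W = {i, y, z}" and zi: "z \<noteq> i" "z \<noteq> y" using z iW yi by auto
  have jne: "j \<noteq> y" "j \<noteq> z" "j \<noteq> i" using jW Weq ij by auto
  have zA0: "z \<notin> A0" using y zi Weq by auto
  define R where "R = X - {i, j, y, z}"
  have R: "finite R" "R \<subseteq> X - W" "card R = card X - 4"
  proof -
    have "card R = card X - card {i, j, y, z}"
      unfolding R_def using ij W Weq by (intro card_Diff_subset) auto
    then show "card R = card X - 4" using jne yi zi by simp
  qed (use X Weq in \<open>auto simp: R_def\<close>)
  \<comment> \<open>Since \<open>3 * k \<le> card X\<close>, there is room to avoid two other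
    remainders, or a whole \<open>k\<close>-set.\<close>
  have pick: "\<exists>D\<in>nsets R (k - 2). D \<inter> Y = {}" if "finite Y" "card Y + (k - 2) \<le> card X - 4" for Y
  proof -
    have "card R - card Y \<le> card (R - Y)" using that by (intro diff_card_le_card_Diff)
    then have "k - 2 \<le> card (R - Y)" using that R(3) by simp
    then obtain D where "D \<subseteq> R - Y" "card D = k - 2" "finite D"
      using obtain_subset_with_card_n by metis
    then show ?thesis by (intro bexI[of _ D]) (auto simp: nsets_def)
  qed
  have Dout: "D \<subseteq> X" "i \<notin> D" "j \<notin> D" "y \<notin> D" "z \<notin> D" "finite D" "card D = k - 2" 
    if "D \<in> nsets R (k - 2)" for D
    using that unfolding R_def by (auto simp: nsets_def)
  have DW: "D \<in> nsets (X - W) (k - 2)" if "D \<in> nsets R (k - 2)" for D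
    using that R(2) by (auto simp: nsets_def)
  have inS: "B \<in> F \<or> (i \<in> B \<and> insert j (B - {i}) \<in> F)" if "B \<in> ?S" for B
  proof -
    obtain A where A: "A \<in> F" "B = shift_set i j F A" using \<open>B \<in> ?S\<close> unfolding shift_def by blast
    show ?thesis
    proof (cases "B = A")
      case False
      then have "j \<in> A" "i \<notin> A" "B = insert i (A - {j})"
        using A unfolding shift_set_def by (auto split: if_splits)
      moreover from this have "insert j (B - {i}) = A" by auto
      ultimately show ?thesis using A by simp
    qed (use A in simp)
  qed
  have choice: "{i, u} \<union> D \<in> F \<or> {j, u} \<union> D \<in> F"
    if D: "D \<in> nsets R (k - 2)" and u: "u = y \<or> u = z" for D u
  proof -
    obtain x where x: "x \<in> W" "W - {x} = {i, u}"
      using u Weq yi zi by (cases "u = y") (auto intro: that[of z] that[of y])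
    then have "{i, u} \<union> D \<in> ?S" using full[OF x(1) DW[OF D]] by simp
    moreover have "insert j (({i, u} \<union> D) - {i}) = {j, u} \<union> D"
      using Dout[OF D] u yi zi by auto
    ultimately show ?thesis using inS by metis
  qed
  have meet: "A \<inter> B \<noteq> {}" if "A \<in> F" "B \<in> F" for A B
    using that F(2) unfolding intersecting_def by blast
  \<comment> \<open>\<open>{j, y} \<union> D\<close> and \<open>{i, z} \<union> D'\<close> are
    disjoint, so \<open>D'\<close> is left with the choice of \<open>j\<close>.\<close>
  have cross1: "{j, z} \<union> D' \<in> F"
    if "{j, y} \<union> D \<in> F" "D \<inter> D' = {}" "D \<in> nsets R (k - 2)" "D' \<in> nsets R (k - 2)" for D D'
  proof (rule ccontr)
    assume "{j, z} \<union> D' \<notin> F"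
    then have "{i, z} \<union> D' \<in> F" using choice that by blast
    from meet[OF that(1) this] show False
      using that(2) Dout[OF that(3)] Dout[OF that(4)] jne yi zi by auto
  qed
  have cross2: "{j, y} \<union> D' \<in> F"
    if "{j, z} \<union> D \<in> F" "D \<inter> D' = {}" "D \<in> nsets R (k - 2)" "D' \<in> nsets R (k - 2)" for D D'
  proof (rule ccontr)
    assume "{j, y} \<union> D' \<notin> F"
    then have "{i, y} \<union> D' \<in> F" using choice that by blast
    from meet[OF that(1) this] show False
      using that(2) Dout[OF that(3)] Dout[OF that(4)] jne yi zi by auto
  qed
  define D0 where "D0 = A0 - {j, y}"
  have D0: "D0 \<in> nsets R (k - 2)"
  proof -
    have "card D0 = card A0 - card {j, y}"
      unfolding D0_def using moved yi by (intro card_Diff_subset) auto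
    then have "card D0 = k - 2" using jne finA0 by simp
    then show ?thesis
      using finA0 moved zA0 unfolding D0_def R_def by (auto simp: nsets_def)
  qed
  have "{j, y} \<union> D0 = A0" unfolding D0_def using moved yi by auto
  then have jy0: "{j, y} \<union> D0 \<in> F" using A0 by simp
  \<comment> \<open>Two steps in the Kneser graph: some \<open>D'\<close> is disjoint from both
    \<open>D0\<close> and \<open>D\<close>.\<close>
  have jy: "{j, y} \<union> D \<in> F" if D: "D \<in> nsets R (k - 2)" for D
  proof -
    have "card (D0 \<union> D) \<le> (k - 2) + (k - 2)"
      using card_Un_le[of D0 D] Dout(7)[OF D] Dout(7)[OF D0] by simp
    then have "card (D0 \<union> D) + (k - 2) \<le> card X - 4" using k by arith
    then obtain D' where D': "D' \<in> nsets R (k - 2)" "D' \<inter> (D0 \<union> D) = {}"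
      using pick[of "D0 \<union> D"] Dout(6)[OF D] Dout(6)[OF D0] by auto
    have "{j, z} \<union> D' \<in> F" using cross1[OF jy0 _ D0 D'(1)] D'(2) by blast
    then show ?thesis using cross2[OF _ _ D'(1) D] D'(2) by blast
  qed
  have jz: "{j, z} \<union> D \<in> F" if D: "D \<in> nsets R (k - 2)" for D
  proof -
    have "card D + (k - 2) \<le> card X - 4" using Dout(7)[OF D] k by arith
    then obtain D' where D': "D' \<in> nsets R (k - 2)" "D' \<inter> D = {}"
      using pick[of D] Dout(6)[OF D] by auto
    then show ?thesis using cross1[OF jy[OF D'(1)] D'(2) D'(1) D] by blast
  qed
  have yz: "{y, z} \<union> D \<in> F" if D: "D \<in> nsets R (k - 2)" for D
  proof -
    have "W - {i} = {y, z}" using Weq yi zi by auto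
    then have "{y, z} \<union> D \<in> ?S" using full[OF iW DW[OF D]] by simp
    moreover have "i \<notin> {y, z} \<union> D" using Dout[OF D] yi zi by auto
    ultimately show ?thesis using inS by blast
  qed
  have "two_of {j, y, z} F"
    unfolding two_of_def
  proof
    fix A assume A: "A \<in> F"
    have "finite A" "card A = k" using A F(1) by (auto simp: nsets_def)
    moreover from this have "card A + (k - 2) \<le> card X - 4" using k by arith
    \<comment> \<open>As \<open>D\<close> avoids \<open>A\<close>, the set \<open>A\<close> has to
      meet the three sets below inside the triangle \<open>{j, y, z}\<close>.\<close>
    ultimately obtain D where D: "D \<in> nsets R (k - 2)" "D \<inter> A = {}"
      using pick[of A] by auto
    have "({j, y} \<union> D) \<inter> A \<noteq> {}" "({j, z} \<union> D) \<inter> A \<noteq> {}" "({y, z} \<union> D) \<inter> A \<noteq> {}"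
      using meet[OF jy[OF D(1)] A] meet[OF jz[OF D(1)] A] meet[OF yz[OF D(1)] A] .
    then have "{j, y} \<subseteq> A \<inter> {j, y, z} \<or> {j, z} \<subseteq> A \<inter> {j, y, z} \<or> {y, z} \<subseteq> A \<inter> {j, y, z}"
      using D(2) by auto
    moreover have "2 = card {j, y}" "2 = card {j, z}" "2 = card {y, z}"
      using jne yi zi by auto
    ultimately show "2 \<le> card (A \<inter> {j, y, z})"
      by (metis card_mono finite.emptyI finite.insertI finite_Int)
  qed
  moreover have "card {j, y, z} = 3" using jne yi zi by simp
  moreover have "{j, y, z} \<subseteq> X" using ij W Weq by auto
  ultimately show ?thesis by blast
qed

section \<open>Excluding exceptional sets\<close>

text \<open>At \<open>t = 1\<close> the overfull sets have density at most
  \<open>4 * m / card Q\<close>, hence at most a quarter.\<close>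

lemma card_not_overfull_ge:
  assumes "finite Q" "16 * m \<le> card Q"
  shows "real (card Q choose m) \<le> 2 * real (card {D \<in> nsets Q m. \<not> overfull Q 1 D})"
proof -
  have ratio: "real m / real (card Q) \<le> 1 / 16"
    using assms(2) by (auto simp: divide_simps)
  have "real (card {D \<in> nsets Q m. overfull Q 1 D}) \<le> 2 * (2 * (real m / real (card Q))) * real (card Q choose m)"
    using card_overfull_le[OF assms(1) subset_refl assms(2), of 1] by simp
  also have "\<dots> \<le> (1/2) * real (card Q choose m)"
  proof (rule mult_right_mono)
    show "2 * (2 * (real m / real (card Q))) \<le> 1/2" using ratio by linarith
  qed simp
  finally have over: "real (card {D \<in> nsets Q m. overfull Q 1 D}) \<le> (1/2) * real (card Q choose m)" .
  have "{D \<in> nsets Q m. overfull Q 1 D} \<union> {D \<in> nsets Q m. \<not> overfull Q 1 D} = nsets Q m" by blast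
  then have "card Q choose m \<le> card {D \<in> nsets Q m. overfull Q 1 D} + card {D \<in> nsets Q m. \<not> overfull Q 1 D}"
    using card_nsets_eq[OF assms(1), of m]
      card_Un_le[of "{D \<in> nsets Q m. overfull Q 1 D}" "{D \<in> nsets Q m. \<not> overfull Q 1 D}"]
    by (simp only:)
  then have "real (card Q choose m) \<le> real (card {D \<in> nsets Q m. overfull Q 1 D})
      + real (card {D \<in> nsets Q m. \<not> overfull Q 1 D})" by linarith
  then show ?thesis using over by linarith
qed

text \<open>Of the sets meeting \<open>W\<close> in at most \<open>{x}\<close> pick one of least excess \<open>t\<close> on initial segments.
  It can be shifted away from \<open>(W - {x}) \<union> D\<close> for a \<open>2\<^sup>-\<^sup>t\<close> proportion of all \<open>D\<close>,
  whereas all these sets have excess \<open>t\<close>, so they form only an \<open>O(p)\<^sup>t\<close> proportion.\<close>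
lemma two_of_if_almost:
  fixes X R W :: "nat set" and k :: nat and G :: "nat set set"
  defines "p \<equiv> real k / real (card X)"
    and "\<beta> \<equiv> (card X - 3) choose (k - 2)"
  assumes X: "finite X" and k: "2 \<le> k" "10 ^ 8 * k \<le> card X"
    and G: "G \<subseteq> nsets X k" "intersecting G"
    and R: "R \<subseteq> X" "card (X - R) \<le> 10"
    and stable: "\<And>B i j. \<lbrakk>B \<in> G; i \<in> R; j \<in> R; i < j; j \<in> B; i \<notin> B\<rbrakk> \<Longrightarrow> insert i (B - {j}) \<in> G"
    and W: "W \<subseteq> X" "card W = 3"
    and few: "real (card {A \<in> G. card (A \<inter> W) < 2}) \<le> 2304 * p * real \<beta>"
    and many: "\<And>x. x \<in> W \<Longrightarrow> \<beta> \<le> card {A \<in> G. x \<notin> A}"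
  shows "two_of W G"
proof (rule ccontr)
  assume "\<not> two_of W G"
  have finG: "finite G" using G X finite_nsets finite_subset by metis
  have finW: "finite W" using W X finite_subset by blast
  have "card X > 0" using k by (cases "card X") auto
  have "10 ^ 8 * real k \<le> real (card X)"
    using of_nat_mono[OF k(2), where ?'a = real] by simp
  then have p: "p \<le> 1 / 10 ^ 8" "0 \<le> p"
    using \<open>card X > 0\<close> unfolding p_def by (auto simp: divide_simps)
  have \<beta>pos: "0 < \<beta>"
    unfolding \<beta>_def using k by (intro zero_less_binomial) auto
  have k16: "16 * k \<le> card X" using k(2) by simp
  \<comment> \<open>Members of \<open>Bad x\<close> avoid the pair \<open>W - {x}\<close>; this
    includes the sets disjoint from \<open>W\<close>.\<close>
  define Bad where "Bad x = {A \<in> G. A \<inter> W \<subseteq> {x}}" for x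
  have finBad: "finite (Bad x)" for x unfolding Bad_def using finG by simp
  have small_in_Bad: "\<exists>w\<in>W. A \<in> Bad w" if "A \<in> G" "card (A \<inter> W) < 2" for A
  proof -
    have "card (A \<inter> W) = 0 \<or> card (A \<inter> W) = 1" using that(2) by linarith
    then obtain w where "A \<inter> W = {} \<or> A \<inter> W = {w}" using finW by (auto simp: card_1_singleton_iff)
    moreover obtain w' where "w' \<in> W" using W(2) by fastforce
    ultimately show ?thesis using that(1) unfolding Bad_def by blast
  qed
  have "Max ((\<lambda>x. card (Bad x)) ` W) \<in> (\<lambda>x. card (Bad x)) ` W"
    using finW W(2) by (intro Max_in) auto
  \<comment> \<open>With \<open>x\<close> maximising \<open>card (Bad x)\<close>, there are at most
    \<open>3 * card (Bad x)\<close> bad sets altogether.\<close>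
  then obtain x where x: "x \<in> W" "card (Bad x) = Max ((\<lambda>x. card (Bad x)) ` W)" by force
  have xmax: "card (Bad w) \<le> card (Bad x)" if "w \<in> W" for w
    using that finW x(2) by simp
  have "Bad x \<noteq> {}"
  proof
    assume "Bad x = {}"
    then have "Bad w = {}" if "w \<in> W" for w using xmax[OF that] finBad by simp
    then show False using \<open>\<not> two_of W G\<close> small_in_Bad unfolding two_of_def by (metis empty_iff not_le)
  qed
  define e where "e = W - {x}"
  have e: "card e = 2" "e \<subseteq> W" "finite e" unfolding e_def using W x finW by auto
  define m where "m = k - 2"
  define GD where "GD = {D \<in> nsets (X - W) m. e \<union> D \<in> G}"
  have finXW: "finite (nsets (X - W) m)" using X by (simp add: finite_nsets)
  have cXW: "card (nsets (X - W) m) = \<beta>"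
    using W X finW unfolding \<beta>_def m_def by (simp add: card_nsets_eq card_Diff_subset)
  \<comment> \<open>A set missing \<open>x\<close> is either bad or of the form
    \<open>e \<union> D\<close>. Since \<open>many\<close> provides \<open>\<beta>\<close> of them,
    each \<open>D\<close> absent from \<open>GD\<close> must be compensated by a bad set.\<close>
  have "{A \<in> G. x \<notin> A} \<subseteq> (\<lambda>D. e \<union> D) ` GD \<union> (\<Union>w\<in>W. Bad w)"
  proof
    fix A assume A: "A \<in> {A \<in> G. x \<notin> A}"
    show "A \<in> (\<lambda>D. e \<union> D) ` GD \<union> (\<Union>w\<in>W. Bad w)"
    proof (cases "card (A \<inter> W) < 2")
      case True
      then show ?thesis using small_in_Bad A by blast
    next
      case False
      then have "two_of W {A}" unfolding two_of_def by simp
      then have "A \<in> (\<lambda>D. e \<union> D) ` nsets (X - W) m"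
        using two_of_missing_subset[OF X _ _ W x(1), of "{A}" k] A G(1) unfolding e_def m_def by blast
      then show ?thesis using A unfolding GD_def by blast
    qed
  qed
  then have "card {A \<in> G. x \<notin> A} \<le> card ((\<lambda>D. e \<union> D) ` GD \<union> (\<Union>w\<in>W. Bad w))"
    using finXW finBad finW unfolding GD_def by (intro card_mono) auto
  also have "\<dots> \<le> card ((\<lambda>D. e \<union> D) ` GD) + card (\<Union>w\<in>W. Bad w)" by (rule card_Un_le)
  also have "\<dots> \<le> card GD + (\<Sum>w\<in>W. card (Bad w))"
    using finXW finW unfolding GD_def by (intro add_mono card_image_le card_UN_le) auto
  also have "(\<Sum>w\<in>W. card (Bad w)) \<le> 3 * card (Bad x)"
    using sum_bounded_above[of W "\<lambda>w. card (Bad w)" "card (Bad x)"] xmax W(2) by simp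
  finally have lower: "\<beta> \<le> card GD + 3 * card (Bad x)" using many[OF x(1)] by simp
  define R' where "R' = R - W"
  have R': "R' \<subseteq> X" "finite R'" "R' \<inter> W = {}" using R X finite_subset unfolding R'_def by auto
  have cR': "card X \<le> card R' + 13"
  proof -
    have "X \<subseteq> R' \<union> ((X - R) \<union> W)" unfolding R'_def by auto
    then have "card X \<le> card (R' \<union> ((X - R) \<union> W))" 
      using R' X finW by (intro card_mono) auto
    also have "\<dots> \<le> card R' + card ((X - R) \<union> W)" by (rule card_Un_le)
    also have "card ((X - R) \<union> W) \<le> card (X - R) + card W" by (rule card_Un_le)
    finally show ?thesis using R(2) W(2) by simp
  qed
  \<comment> \<open>\<open>\<not> overfull R' (Suc t)\<close> means excess at most \<open>t\<close>.
    By minimality every bad set for \<open>x\<close> is overfull at \<open>t\<close>, provided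
    \<open>t > 0\<close>.\<close>
  define t where "t = (LEAST t. \<exists>B\<in>Bad x. \<not> overfull R' (Suc t) B)"
  have ex: "\<exists>B\<in>Bad x. \<not> overfull R' (Suc k) B"
  proof -
    obtain B where B: "B \<in> Bad x" using \<open>Bad x \<noteq> {}\<close> by blast
    then have "finite B" "card B = k" using G(1) unfolding Bad_def by (auto simp: nsets_def)
    then have "card (B \<inter> seg R' v) \<le> k" "card (B \<inter> seg R' v) \<le> card (seg R' v)" for v
      using card_mono[of B "B \<inter> seg R' v"] card_mono[of "seg R' v" "B \<inter> seg R' v"] R'(2) by auto
    then have "2 * card (B \<inter> seg R' v) < card (seg R' v) + Suc k" for v
      by (metis add_mono less_Suc_eq_le add_Suc_right mult_2)
    then have "\<not> overfull R' (Suc k) B" unfolding overfull_def by (auto simp: not_le)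
    then show ?thesis using B by blast
  qed
  from LeastI[where P = "\<lambda>t. \<exists>B\<in>Bad x. \<not> overfull R' (Suc t) B", OF ex]
  obtain B0 where B0: "B0 \<in> Bad x" "\<not> overfull R' (Suc t) B0"
    unfolding t_def by blast
  have tk: "t \<le> k" unfolding t_def using ex by (rule Least_le)
  have over: "overfull R' t B" if "B \<in> Bad x" "0 < t" for B
  proof (rule ccontr)
    assume "\<not> overfull R' t B"
    then have "\<exists>B\<in>Bad x. \<not> overfull R' (Suc (t - 1)) B" using that by auto
    then have "t \<le> t - 1" unfolding t_def by (rule Least_le)
    then show False using that by simp
  qed
  have "t \<le> card R'" using tk k cR' by simp
  \<comment> \<open>Keeping \<open>D\<close> off the first \<open>t\<close> elements makes up for
    the excess of \<open>B0\<close>.\<close>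
  then obtain I where I: "I \<subseteq> R'" "card I = t" "\<And>x y. x \<in> I \<Longrightarrow> y \<in> R' - I \<Longrightarrow> x < y"
    using obtain_initial_segment[OF R'(2)] by metis
  have finI: "finite I" using I R' finite_subset by blast
  define Q where "Q = R' - I"
  have Q: "Q \<subseteq> R'" "finite Q" "card Q = card R' - t" "Q \<inter> I = {}"
    using I R' finI unfolding Q_def by (auto simp: card_Diff_subset)
  define DD where "DD = {D \<in> nsets Q m. \<not> overfull Q 1 D}"
  have avoid: "e \<union> D \<notin> G" if D: "D \<in> DD" for D
  proof
    assume eD: "e \<union> D \<in> G"
    have DQ: "D \<subseteq> Q" "\<not> overfull Q 1 D" using D unfolding DD_def by (auto simp: nsets_def)
    have DR: "(e \<union> D) \<inter> seg R' v = D \<inter> seg R' v" for v using e R' by blast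
    have "card ((e \<union> D) \<inter> seg R' v) + card (B0 \<inter> seg R' v) \<le> card (seg R' v)" if v: "v \<in> R'" for v
    proof (cases "v \<in> I")
      case True
      have "seg R' v \<subseteq> I" using seg_in_initial[OF I(3) True] .
      then have "D \<inter> seg R' v = {}" using DQ Q by blast
      moreover have "card (B0 \<inter> seg R' v) \<le> card (seg R' v)" using R' by (intro card_mono) auto
      ultimately show ?thesis unfolding DR by simp
    next
      case False
      then have vQ: "v \<in> Q" using v unfolding Q_def by auto
      have eq: "seg R' v = I \<union> seg Q v"
        unfolding Q_def using seg_after_initial[OF I(1,3)] vQ unfolding Q_def by simp
      have "card (seg R' v) = t + card (seg Q v)"
        unfolding eq I(2)[symmetric] using finI Q by (intro card_Un_disjoint) auto
      moreover have "D \<inter> seg R' v = D \<inter> seg Q v" using eq DQ Q by blast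
      then have "card (D \<inter> seg R' v) = card (D \<inter> seg Q v)" by simp
      moreover have "2 * card (D \<inter> seg Q v) < card (seg Q v) + 1"
        using DQ(2) vQ unfolding overfull_def by (auto simp: not_le)
      moreover have "2 * card (B0 \<inter> seg R' v) < card (seg R' v) + Suc t"
        using B0(2) v unfolding overfull_def by (auto simp: not_le)
      ultimately show ?thesis unfolding DR by linarith
    qed
    moreover have "B0 \<in> G" "B0 \<inter> W \<subseteq> {x}" using B0 unfolding Bad_def by auto
    moreover have "insert i (B - {j}) \<in> G" if "B \<in> G" "i \<in> R'" "j \<in> R'" "i < j" "j \<in> B" "i \<notin> B" for B i j
      using stable that unfolding R'_def by blast
    ultimately obtain B' where B': "B' \<in> G" "B' - R' = B0 - R'" "(e \<union> D) \<inter> B' \<inter> R' = {}"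
      using shift_away[OF R'(2), of G B0 "e \<union> D"] by blast
    \<comment> \<open>The pair \<open>e\<close> lies in \<open>W\<close>, outside \<open>R'\<close>,
      where shifting has not altered \<open>B0\<close>.\<close>
    have "e \<inter> B' = {}"
    proof -
      have "e \<inter> B' \<subseteq> e \<inter> (B0 - R')" using B'(2) e(2) R'(3) by blast
      also have "\<dots> \<subseteq> {}" using \<open>B0 \<inter> W \<subseteq> {x}\<close> unfolding e_def by blast
      finally show ?thesis by blast
    qed
    moreover have "D \<inter> B' = {}" using B'(3) DQ(1) Q(1) by blast
    ultimately have "(e \<union> D) \<inter> B' = {}" by blast
    then show False using G(2) eD B'(1) unfolding intersecting_def by blast
  qed
  have "DD \<subseteq> nsets (X - W) m"
    using Q(1) R' unfolding DD_def nsets_def by blast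
  moreover have "GD \<subseteq> nsets (X - W) m" "GD \<inter> DD = {}"
    using avoid unfolding GD_def by auto
  ultimately have "card GD + card DD \<le> \<beta>"
    using card_Un_disjoint[of GD DD] card_mono[OF finXW, of "GD \<union> DD"] finXW cXW finite_subset
    by (metis Un_least)
  then have DD_le: "card DD \<le> 3 * card (Bad x)" using lower by linarith
  \<comment> \<open>\<open>Q\<close> lacks at most \<open>t + 10\<close> elements of
    \<open>X - W\<close>: the \<open>t\<close> elements of \<open>I\<close> and at most ten
    exceptional ones.\<close>
  have "real \<beta> \<le> 2 ^ ((card X - 3) - card Q) * real ((card X - 3 - ((card X - 3) - card Q)) choose m)"
    unfolding \<beta>_def m_def using k Q(3) cR' tk by (intro binomial_le_pow2_diff) simp
  also have "(card X - 3) - ((card X - 3) - card Q) = card Q"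
  proof -
    have "card (Q \<union> W) \<le> card X" using Q(1) R'(1) W(1) X by (intro card_mono) auto
    moreover have "card (Q \<union> W) = card Q + 3"
      using card_Un_disjoint[OF Q(2) finW] Q(1) R'(3) W(2) by auto
    ultimately show ?thesis by simp
  qed
  also have "2 ^ ((card X - 3) - card Q) * real (card Q choose m) \<le> 2 ^ (t + 10) * (2 * real (card DD))"
  proof (intro mult_mono)
    show "(2::real) ^ ((card X - 3) - card Q) \<le> 2 ^ (t + 10)"
      using Q(3) cR' \<open>t \<le> card R'\<close> by (intro power_increasing) auto
    show "real (card Q choose m) \<le> 2 * real (card DD)"
      unfolding DD_def using Q k cR' tk by (intro card_not_overfull_ge) (auto simp: m_def)
  qed auto
  also have "\<dots> \<le> 2 ^ (t + 10) * (2 * (3 * real (card (Bad x))))"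
    using DD_le by (intro mult_left_mono) auto
  \<comment> \<open>The constant 6144 is \<open>2 ^ 10 * 2 * 3\<close>.\<close>
  finally have upper: "real \<beta> \<le> 6144 * (2 ^ t * real (card (Bad x)))" by (simp add: power_add)
  show False
  \<comment> \<open>For \<open>t \<le> 2\<close> the density \<open>O(p) ^ t\<close> does not beat
    \<open>\<beta>\<close>, and \<open>few\<close> is used instead. For larger \<open>t\<close>, two
    factors \<open>p\<close> turn \<open>card X choose k\<close> into \<open>O(\<beta>)\<close> and
    a third makes the bound small.\<close>
  proof (cases "t \<le> 2")
    case True
    have "card (A \<inter> W) < 2" if "A \<in> Bad x" for A
      using card_mono[of "{x}" "A \<inter> W"] that unfolding Bad_def by auto
    then have "card (Bad x) \<le> card {A \<in> G. card (A \<inter> W) < 2}"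
      using finG by (intro card_mono) (auto simp: Bad_def)
    then have "real (card (Bad x)) \<le> 2304 * p * real \<beta>" using few by linarith
    also have "\<dots> \<le> 2304 * (1 / 10 ^ 8) * real \<beta>" using p by (intro mult_mono) auto
    finally have Bx: "real (card (Bad x)) \<le> 2304 / 10 ^ 8 * real \<beta>" by simp
    have "(2::real) ^ t \<le> 2 ^ 2" using True by (intro power_increasing) auto
    then have "2 ^ t * real (card (Bad x)) \<le> 4 * real (card (Bad x))"
      by (intro mult_right_mono) auto
    then have "real \<beta> \<le> 24576 * real (card (Bad x))" using upper by linarith
    then show False using Bx \<beta>pos by simp
  next
    case False
    then obtain s where s: "t = s + 3" using le_Suc_ex[of 3 t] by (auto simp: add.commute)
    have "Bad x \<subseteq> {A \<in> nsets X k. overfull R' t A}"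
      using over False G(1) unfolding Bad_def by auto
    then have "card (Bad x) \<le> card {A \<in> nsets X k. overfull R' t A}"
      using X by (intro card_mono) (auto simp: finite_nsets)
    then have "real (card (Bad x)) \<le> 2 * (2 * p) ^ t * real (card X choose k)"
      using card_overfull_le[OF X R'(1) k16, of t] unfolding p_def by linarith
    then have "2 ^ t * real (card (Bad x)) \<le> 2 ^ t * (2 * (2 * p) ^ t * real (card X choose k))"
      by (intro mult_left_mono) auto
    also have "\<dots> = 2 * (4 * p) ^ t * real (card X choose k)"
    proof -
      have "4 * p = 2 * (2 * p)" by simp
      then have "(4 * p) ^ t = 2 ^ t * (2 * p) ^ t" by (simp only: power_mult_distrib[of 2 "2 * p"])
      then show ?thesis by (simp only: mult.assoc mult.left_commute)
    qed
    also have "(4 * p) ^ t = 64 * p * (4 * p) ^ s * p\<^sup>2"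
      unfolding s by (simp add: power_add power3_eq_cube power2_eq_square)
    also have "2 * (64 * p * (4 * p) ^ s * p\<^sup>2) * real (card X choose k)
        = 128 * p * (4 * p) ^ s * (p\<^sup>2 * real (card X choose k))" by simp
    also have "\<dots> \<le> 128 * (1 / 10 ^ 8) * 1 * (4 * real \<beta>)"
    proof (rule mult_mono)
      have "(4 * p) ^ s \<le> 1" using p by (intro power_le_one) auto
      then show "128 * p * (4 * p) ^ s \<le> 128 * (1 / 10 ^ 8) * 1"
        using p by (intro mult_mono) auto
      show "p\<^sup>2 * real (card X choose k) \<le> 4 * real \<beta>"
        unfolding p_def \<beta>_def using k by (intro binomial_le_sq_binomial) auto
    qed (use p in auto)
    finally have "2 ^ t * real (card (Bad x)) \<le> 512 / 10 ^ 8 * real \<beta>" by simp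
    then have "real \<beta> \<le> 6144 * (512 / 10 ^ 8 * real \<beta>)" using upper by linarith
    then show False using \<beta>pos by simp
  qed
qed

text \<open>Both halves of \<open>P\<close> survive admissible shifts: the count because
  \<open>card G > 2 * \<beta>\<close>, the absence of \<open>W\<close> by
  \<open>two_of_shift_reverse\<close>. In the stuck family a star contradicts the count, and
  \<open>two_of_if_almost\<close> turns the approximate triangle into an exact one.\<close>

lemma two_of_if_diverse:
  fixes X :: "nat set"
  assumes X: "finite X" and k: "2 \<le> k" "10 ^ 8 * k \<le> card X"
    and F: "F \<subseteq> nsets X k" "intersecting F"
    and many: "\<And>x. x \<in> X \<Longrightarrow> (card X - 3) choose (k - 2) \<le> card {A \<in> F. x \<notin> A}"
  shows "\<exists>W\<subseteq>X. card W = 3 \<and> two_of W F"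
proof (rule ccontr)
  assume neg: "\<not> ?thesis"
  define \<beta> where "\<beta> = (card X - 3) choose (k - 2)"
  define P where "P G \<longleftrightarrow> (\<forall>x\<in>X. \<beta> \<le> card {A \<in> G. x \<notin> A}) \<and> \<not> (\<exists>W\<subseteq>X. card W = 3 \<and> two_of W G)" for G
  have "P F" using neg many unfolding P_def \<beta>_def by blast
  have "X \<noteq> {}" using k by auto
  have large: "2 * \<beta> < card G" if G: "G \<subseteq> nsets X k" "intersecting G" "P G" for G
  proof -
    have finG: "finite G" using G X finite_nsets finite_subset by metis
    obtain x where "x \<in> X" using \<open>X \<noteq> {}\<close> by blast
    then have "\<beta> \<le> card {A \<in> G. x \<notin> A}" using G(3) unfolding P_def by blast
    also have "\<dots> \<le> card G" using finG by (intro card_mono) auto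
    finally have "(card X - 3) choose (k - 2) \<le> card G" unfolding \<beta>_def .
    then obtain y where y: "y \<in> X" "card G < 2 * degree G y"
      using exists_degree_gt_half[OF X G(1,2) k(1)] k(2) by auto
    then have "\<beta> \<le> card {A \<in> G. y \<notin> A}" using G(3) unfolding P_def by blast
    then show ?thesis using y(2) degree_plus_missing[OF finG, of y] by linarith
  qed
  have step: "P (shift i j G)"
    if G: "G \<subseteq> nsets X k" "intersecting G" "P G" and ij: "i \<in> X" "j \<in> X" "i < j" "\<not> dominating_pair G i j"
    for G i j
  proof -
    let ?S = "shift i j G"
    have finG: "finite G" using G X finite_nsets finite_subset by metis
    have finS: "finite ?S" using finG unfolding shift_def by simp
    have manyS: "\<beta> \<le> card {A \<in> ?S. x \<notin> A}" if "x \<in> X" for x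
    proof (cases "x = i")
      case True
      \<comment> \<open>At least half of \<open>G\<close> misses both elements, and half of
        \<open>G\<close> exceeds \<open>\<beta>\<close>.\<close>
      have "\<beta> \<le> card {A \<in> G. i \<notin> A \<and> j \<notin> A}"
        using large[OF G] ij(4) unfolding dominating_pair_def by linarith
      then show ?thesis
        using degree_shift_self_le[OF finG, of i j] card_meeting_plus_missing[OF finG, of i j]
          degree_plus_missing[OF finS, of i] card_shift[of i j G] True by simp
    next
      case False
      have "\<beta> \<le> card {A \<in> G. x \<notin> A}" using G(3) that unfolding P_def by blast
      then show ?thesis
        using degree_shift_le[OF finG False, of j] degree_plus_missing[OF finG, of x]
          degree_plus_missing[OF finS, of x] card_shift[of i j G] by simp
    qed
    moreover have "\<not> two_of W ?S" if W: "W \<subseteq> X" "card W = 3" for W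
    proof
      assume "two_of W ?S"
      then have "\<exists>W'\<subseteq>X. card W' = 3 \<and> two_of W' G"
        using two_of_shift_reverse[OF X k(1) _ G(1,2) ij(1,2) _ W] manyS W(1) ij(3) k(2)
        unfolding \<beta>_def by auto
      then show False using G(3) unfolding P_def by blast
    qed
    ultimately show ?thesis unfolding P_def by blast
  qed
  obtain G where G: "G \<subseteq> nsets X k" "intersecting G" "P G" "stuck X G"
    using shift_until_stuck[where P = P, OF X F \<open>P F\<close> step] by blast
  define p where "p = real k / real (card X)"
  define M3 where "M3 = p ^ 3 * real (card X choose k)"
  have "card X > 0" using k by (cases "card X") auto
  have "10 ^ 8 * real k \<le> real (card X)"
    using of_nat_mono[OF k(2), where ?'a = real] by simp
  then have p: "p \<le> 1 / 10 ^ 8" "0 \<le> p"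
    using \<open>card X > 0\<close> unfolding p_def by (auto simp: divide_simps)
  have \<beta>pos: "0 < \<beta>"
    unfolding \<beta>_def using k by (intro zero_less_binomial) auto
  have M3: "M3 \<le> 4 * p * real \<beta>"
    unfolding M3_def p_def \<beta>_def using k by (intro cube_binomial_le) auto
  have "4 * p * real \<beta> \<le> 4 * (1 / 10 ^ 8) * real \<beta>" using p by (intro mult_mono) auto
  then have M3': "M3 \<le> 4 / 10 ^ 8 * real \<beta>" using M3 by simp
  have G2: "2 * real \<beta> < real (card G)" using large[OF G(1-3)] by linarith
  have "880 * M3 < real (card G)" using M3' G2 \<beta>pos by simp
  then have large': "880 * ((real k / real (card X)) ^ 3 * real (card X choose k)) < real (card G)"
    unfolding M3_def p_def .
  have k': "1 \<le> k" "16 * k \<le> card X" using k by auto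
  obtain R where R: "R \<subseteq> X" "card (X - R) \<le> 10"
    and stable: "\<And>B i j. \<lbrakk>B \<in> G; i \<in> R; j \<in> R; i < j; j \<in> B; i \<notin> B\<rbrakk> \<Longrightarrow> insert i (B - {j}) \<in> G"
    and cases: "(\<exists>x\<in>X. real (card {A \<in> G. x \<notin> A}) \<le> 576 * M3) \<or>
     (\<exists>W\<subseteq>X. card W = 3 \<and> real (card {A \<in> G. card (A \<inter> W) < 2}) \<le> 576 * M3)"
    using stuck_family_structure[OF X G(1,2,4) k' large'] unfolding M3_def p_def by blast
  have many': "\<beta> \<le> card {A \<in> G. x \<notin> A}" if "x \<in> X" for x
    using that G(3) unfolding P_def by blast
  from cases show False
  proof (elim disjE bexE exE conjE)
    fix x assume "x \<in> X" "real (card {A \<in> G. x \<notin> A}) \<le> 576 * M3"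
    moreover from this have "real \<beta> \<le> real (card {A \<in> G. x \<notin> A})" using many' by simp
    ultimately show False using M3' \<beta>pos by simp
  next
    fix W assume W: "W \<subseteq> X" "card W = 3" "real (card {A \<in> G. card (A \<inter> W) < 2}) \<le> 576 * M3"
    \<comment> \<open>Here \<open>2304 = 4 * 576\<close>.\<close>
    have "real (card {A \<in> G. card (A \<inter> W) < 2}) \<le> 2304 * p * real \<beta>" using W(3) M3 by simp
    then have "two_of W G"
      using two_of_if_almost[OF X k G(1,2) R stable W(1,2)] many' W(1)
      unfolding p_def \<beta>_def by blast
    then show False using G(3) W unfolding P_def by blast
  qed
qed

section \<open>The diversity bound\<close>

lemma exists_bij_betw_extending:
  assumes "finite X" "A \<subseteq> X" "B \<subseteq> X" "card A = card B"
  obtains \<pi> where "bij_betw \<pi> X X" "\<pi> ` A = B"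
proof -
  have fin: "finite A" "finite B" using assms finite_subset by auto
  obtain f where f: "bij_betw f A B" using finite_same_card_bij[OF fin assms(4)] by blast
  have "card (X - A) = card (X - B)" using assms fin by (simp add: card_Diff_subset)
  then obtain g where g: "bij_betw g (X - A) (X - B)"
    using finite_same_card_bij[of "X - A" "X - B"] assms(1) by auto
  define h where "h x = (if x \<in> A then f x else g x)" for x
  have hA: "bij_betw h A B" using f unfolding h_def by (subst bij_betw_cong[of _ _ f]) auto
  have "bij_betw h (X - A) (X - B)" using g unfolding h_def by (subst bij_betw_cong[of _ _ g]) auto
  then have "bij_betw h (A \<union> (X - A)) (B \<union> (X - B))"
    using hA by (intro bij_betw_combine) auto
  moreover have "A \<union> (X - A) = X" "B \<union> (X - B) = X" using assms by auto
  ultimately have "bij_betw h X X" by simp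
  then show thesis using hA that bij_betw_imp_surj_on by blast
qed

lemma two_of_isomorphic_family_A2:
  assumes W: "W \<subseteq> {1..n}" "card W = 3" and F: "F \<subseteq> nsets {1..n} k" "two_of W F"
  shows "\<exists>G. isomorphic_families n G (family_A2 n k) \<and> F \<subseteq> G"
proof -
  have "card W \<le> card {1..n}" using W(1) by (intro card_mono) auto
  then have "{1..3} \<subseteq> {1..n}" using W(2) by auto
  then obtain \<pi> where \<pi>: "bij_betw \<pi> {1..n} {1..n}" "\<pi> ` {1..3} = W"
    using exists_bij_betw_extending[of "{1..n}" "{1..3}" W] W by auto
  have "A \<in> (\<lambda>A. \<pi> ` A) ` family_A2 n k" if "A \<in> F" for A
  proof -
    have A: "A \<subseteq> {1..n}" "card A = k" "2 \<le> card (A \<inter> W)"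
      using that F unfolding two_of_def by (auto simp: nsets_def)
    define B where "B = {x \<in> {1..n}. \<pi> x \<in> A}"
    have inj: "inj_on \<pi> {1..n}" using \<pi>(1) by (rule bij_betw_imp_inj_on)
    have "A \<subseteq> \<pi> ` {1..n}" using bij_betw_imp_surj_on[OF \<pi>(1)] A(1) by simp
    then have img: "\<pi> ` B = A" unfolding B_def by auto
    have "\<pi> ` (B \<inter> {1..3}) = \<pi> ` B \<inter> \<pi> ` {1..3}"
      using inj \<open>{1..3} \<subseteq> {1..n}\<close> unfolding B_def by (intro inj_on_image_Int[of _ "{1..n}"]) auto
    then have "\<pi> ` (B \<inter> {1..3}) = A \<inter> W" using img \<pi>(2) by simp
    moreover have "card (\<pi> ` Y) = card Y" if "Y \<subseteq> {1..n}" for Y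
      using inj that by (intro card_image) (rule inj_on_subset)
    ultimately have "card (B \<inter> {1..3}) = card (A \<inter> W)" "card B = k"
      using A(2) img unfolding B_def by (metis (no_types, lifting) inf.coboundedI1 mem_Collect_eq subsetI)+
    then have "B \<in> family_A2 n k"
      using A(3) unfolding family_A2_def B_def by (auto simp: nsets_def)
    then show ?thesis using img by blast
  qed
  then show ?thesis
    using \<pi>(1) unfolding isomorphic_families_def by blast
qed

section \<open>From diversity to sets missing an element\<close>

lemma degree_le_max_degree: "x \<in> {1..n} \<Longrightarrow> degree F x \<le> max_degree n F"
  unfolding max_degree_def by (intro Max_ge) auto

lemma diversity_le_missing:
  assumes "finite F" "x \<in> {1..n}"
  shows "diversity n F \<le> card {A \<in> F. x \<notin> A}"
  using degree_le_max_degree[OF assms(2), of F] degree_plus_missing[OF assms(1), of x]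
  unfolding diversity_def by linarith

theorem theorem2:
  shows "\<exists>C::real. C > 0 \<and>
    (\<forall>(n::nat) (k::nat) (F::nat set set).
       real n > C * real k \<and> C * real k > 0 \<and>
       F \<subseteq> nsets {1..n} k \<and> intersecting F \<longrightarrow>
         diversity n F \<le> binom (n - 3) (int k - 2) \<and>
         (k \<ge> 2 \<and> diversity n F = binom (n - 3) (int k - 2) \<longrightarrow>
            (\<exists>G. isomorphic_families n G (family_A2 n k) \<and> F \<subseteq> G)))"
proof (intro exI[of _ "10 ^ 8"] conjI allI impI)
  \<comment> \<open>The constant has to exceed \<open>24576 * 2304\<close>, the larger of the
    products in the two final contradictions of \<open>two_of_if_almost\<close>.\<close>
  show "(0::real) < 10 ^ 8" by simp
next
  fix n k :: nat and F :: "nat set set"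
  assume asm: "real n > 10 ^ 8 * real k \<and> 10 ^ 8 * real k > 0 \<and>
       F \<subseteq> nsets {1..n} k \<and> intersecting F"
  have F: "F \<subseteq> nsets {1..n} k" "intersecting F" using asm by auto
  have "0 < k" using asm by simp
  have "real (10 ^ 8 * k) < real n" using asm by simp
  then have n: "10 ^ 8 * k \<le> n" by linarith
  have finF: "finite F" using F finite_nsets finite_subset by (metis finite_atLeastAtMost)
  \<comment> \<open>The diversity bounds from below the number of sets missing any given element.
    Assuming only an inequality serves both the upper bound and the case of equality.\<close>
  have struct: "\<exists>W\<subseteq>{1..n}. card W = 3 \<and> two_of W F"
    if "2 \<le> k" "(n - 3) choose (k - 2) \<le> diversity n F"
    using two_of_if_diverse[of "{1..n}" k F] diversity_le_missing[OF finF] that n F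
    by (auto intro: order_trans)
  have binom: "binom (n - 3) (int k - 2) = (n - 3) choose (k - 2)" if "2 \<le> k"
    using that unfolding binom_def by (simp add: nat_diff_distrib)
  show "diversity n F \<le> binom (n - 3) (int k - 2)"
  proof (cases "2 \<le> k")
    case True
    show ?thesis
    proof (rule ccontr)
      assume neg: "\<not> ?thesis"
      then obtain W where W: "W \<subseteq> {1..n}" "card W = 3" "two_of W F"
        using struct True binom by auto
      then obtain x where x: "x \<in> W" by fastforce
      \<comment> \<open>An element of the triangle is itself missed by at most
        \<open>\<beta>\<close> sets.\<close>
      then have "diversity n F \<le> card {A \<in> F. x \<notin> A}"
        using W(1) finF by (intro diversity_le_missing) auto
      also have "\<dots> \<le> (n - 3) choose (k - 2)"
        using card_missing_two_of_le[of "{1..n}" F k W x] F W x by simp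
      finally show False using neg binom True by simp
    qed
  next
    case False
    then have "k = 1" using \<open>0 < k\<close> by simp
    \<comment> \<open>For \<open>k = 1\<close> the lower index is \<open>-1\<close> and the bound is
      zero; intersecting singletons coincide.\<close>
    have "diversity n F = 0"
    proof (cases "F = {}")
      case True
      then show ?thesis unfolding diversity_def by simp
    next
      case False
      then obtain A where A: "A \<in> F" by blast
      then have "card A = 1" "A \<subseteq> {1..n}" using F \<open>k = 1\<close> by (auto simp: nsets_def)
      then obtain x where x: "A = {x}" "x \<in> {1..n}" by (auto simp: card_1_singleton_iff)
      then have "{A \<in> F. x \<notin> A} = {}" using A F(2) unfolding intersecting_def by blast
      then show ?thesis
        using diversity_le_missing[OF finF x(2)] by (simp only: card.empty le_zero_eq)
    qed
    then show ?thesis by simp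
  qed
  show "\<exists>G. isomorphic_families n G (family_A2 n k) \<and> F \<subseteq> G"
    if "2 \<le> k \<and> diversity n F = binom (n - 3) (int k - 2)"
    using struct that binom two_of_isomorphic_family_A2[OF _ _ F(1)] by auto
qed

end
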